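(* Let $X$ be a finite ground set with $|X|=n$, let $d:X\times X\to\mathbb{R}_{\ge 0}$ be a distance function of negative type, and let $M=(X,\mathcal{I})$ be a matroid of rank $k$, given by an independence oracle. There is an algorithm that returns a set $A\in\mathcal{I}$ with $d(A)\ge \left(1-\frac{5}{k}\right)\max\{d(S)\mid S\in\mathcal{I}\}$ and runs in $O(nk^2\log k)$ time, when each distance evaluation and each call to the independence oracle is counted as unit time.
   Context: A distance function on a finite set $X$ is a symmetric function $d:X\times X\to\mathbb{R}_{\ge0}$ with $d(a,a)=0$ for all $a\in X$ (it need not be a metric). It is of negative type if its matrix $D\in\mathbb{R}^{X\times X}$, $D_{a,b}=d(a,b)$, satisfies $x^TDx\le 0$ for all $x\in\mathbb{R}^X$ with $\sum_{a\in X}x_a=0$. The dispersion of $A\subseteq X$ is $d(A)=\sum_{\{a,b\}\subseteq A}d(a,b)$ (sum over unordered pairs of distinct elements). The problem considered is max-sum diversification: maximize $d(A)$ over independent sets $A$ of the matroid. *)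

theory Defs
  imports Complex_Main
begin

definition distance_on :: "'a set \<Rightarrow> ('a \<Rightarrow> 'a \<Rightarrow> real) \<Rightarrow> bool" where
  "distance_on X d \<longleftrightarrow>
     (\<forall>a\<in>X. \<forall>b\<in>X. 0 \<le> d a b \<and> d a b = d b a) \<and> (\<forall>a\<in>X. d a a = 0)"

definition negative_type :: "'a set \<Rightarrow> ('a \<Rightarrow> 'a \<Rightarrow> real) \<Rightarrow> bool" where
  "negative_type X d \<longleftrightarrow>
     (\<forall>x :: 'a \<Rightarrow> real. (\<Sum>a\<in>X. x a) = 0 \<longrightarrow> (\<Sum>a\<in>X. \<Sum>b\<in>X. x a * d a b * x b) \<le> 0)"

text \<open>The value of a symmetric \<open>d\<close> on an unordered pair; see \<open>pair_dist_eq\<close> below.\<close>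

definition pair_dist :: "('a \<Rightarrow> 'a \<Rightarrow> real) \<Rightarrow> 'a set \<Rightarrow> real" where
  "pair_dist d P = (THE r. \<exists>a b. P = {a, b} \<and> r = d a b)"

definition dispersion :: "('a \<Rightarrow> 'a \<Rightarrow> real) \<Rightarrow> 'a set \<Rightarrow> real" where
  "dispersion d A = (\<Sum>P | P \<subseteq> A \<and> card P = 2. pair_dist d P)"

lemma pair_dist_eq:
  assumes "d a b = d b a"
  shows "pair_dist d {a, b} = d a b"
  unfolding pair_dist_def
  by (rule the_equality) (use assms in \<open>auto simp: doubleton_eq_iff\<close>)

lemma dispersion_insert:
  assumes A: "finite A" "b \<notin> A" and sym: "\<And>a. a \<in> A \<Longrightarrow> d a b = d b a"
  shows "dispersion d (insert b A) = dispersion d A + (\<Sum>a\<in>A. d a b)"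
proof -
  let ?N = "(\<lambda>a. {a, b}) ` A"
  have split: "{P. P \<subseteq> insert b A \<and> card P = 2} = {P. P \<subseteq> A \<and> card P = 2} \<union> ?N"
  proof (intro equalityI subsetI)
    fix P assume P: "P \<in> {P. P \<subseteq> insert b A \<and> card P = 2}"
    then obtain x y where "P = {x, y}" "x \<noteq> y" by (auto simp: card_2_iff)
    with P show "P \<in> {P. P \<subseteq> A \<and> card P = 2} \<union> ?N"
      by (cases "b = x"; cases "b = y") auto
  next
    fix P assume "P \<in> {P. P \<subseteq> A \<and> card P = 2} \<union> ?N"
    with A show "P \<in> {P. P \<subseteq> insert b A \<and> card P = 2}"
      by (auto simp: card_insert_if)
  qed
  have "inj_on (\<lambda>a. {a, b}) A"
    using A by (auto simp: inj_on_def doubleton_eq_iff)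
  then have N: "(\<Sum>P\<in>?N. pair_dist d P) = (\<Sum>a\<in>A. d a b)"
    by (simp add: sum.reindex pair_dist_eq sym)
  have "{P. P \<subseteq> A \<and> card P = 2} \<inter> ?N = {}" using A by auto
  then show ?thesis
    unfolding dispersion_def split using A N by (subst sum.union_disjoint) auto
qed

locale matroid =
  fixes X :: "'a set" and \<I> :: "'a set set"
  assumes finite_ground: "finite X"
    and indep_subset: "S \<in> \<I> \<Longrightarrow> S \<subseteq> X"
    and empty_indep: "{} \<in> \<I>"
    and hereditary: "T \<in> \<I> \<Longrightarrow> S \<subseteq> T \<Longrightarrow> S \<in> \<I>"
    and exchange: "S \<in> \<I> \<Longrightarrow> T \<in> \<I> \<Longrightarrow> card S < card T \<Longrightarrow> \<exists>a\<in>T - S. insert a S \<in> \<I>"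

definition matroid_rank :: "'a set set \<Rightarrow> nat" where
  "matroid_rank \<I> = Max (card ` \<I>)"


text \<open>
  Model of computation: a unit-cost real RAM with two oracles, presented as a structured
  language.  The memory consists of arrays of natural numbers and arrays of reals (a program
  names only finitely many of them; a scalar is an array accessed at index \<open>0\<close>).
  The only arithmetic is addition, (truncated) subtraction and comparison, natural numbers and
  reals cannot be converted into each other, and the only real constant is \<open>0\<close>.  Hence every
  instruction is available, at constant cost, on any of the usual unit-cost real RAMs.

  Elements of a ground set of size \<open>n\<close> are named by \<open>0, \<dots>, n - 1\<close>.  A program can
  inspect the instance only through \<open>Dist i j\<close>, a distance evaluation, and
  \<open>Indep a l\<close>, which asks whether the elements listed in \<open>a[0], \<dots>, a[l - 1]\<close> form an
  independent set.
\<close>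

type_synonym vname = string

datatype nexp =
    N nat
  | NArr vname nexp
  | NAdd nexp nexp
  | NSub nexp nexp

datatype rexp =
    RZero
  | RArr vname nexp
  | RAdd rexp rexp
  | RSub rexp rexp
  | Dist nexp nexp

datatype bexp =
    NLess nexp nexp
  | RLess rexp rexp
  | BNot bexp
  | BAnd bexp bexp
  | Indep vname nexp

datatype com =
    Skip
  | NAssign vname nexp nexp
  | RAssign vname nexp rexp
  | Seq com com
  | Cond bexp com com
  | While bexp com

record state =
  nats :: "vname \<Rightarrow> nat \<Rightarrow> nat"
  reals :: "vname \<Rightarrow> nat \<Rightarrow> real"

record oracles =
  dist_oracle :: "nat \<Rightarrow> nat \<Rightarrow> real"
  indep_oracle :: "nat set \<Rightarrow> bool"

primrec nval :: "nexp \<Rightarrow> state \<Rightarrow> nat" where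
  "nval (N m) s = m"
| "nval (NArr x i) s = nats s x (nval i s)"
| "nval (NAdd p q) s = nval p s + nval q s"
| "nval (NSub p q) s = nval p s - nval q s"

primrec rval :: "oracles \<Rightarrow> rexp \<Rightarrow> state \<Rightarrow> real" where
  "rval orc RZero s = 0"
| "rval orc (RArr x i) s = reals s x (nval i s)"
| "rval orc (RAdd p q) s = rval orc p s + rval orc q s"
| "rval orc (RSub p q) s = rval orc p s - rval orc q s"
| "rval orc (Dist i j) s = dist_oracle orc (nval i s) (nval j s)"

primrec bval :: "oracles \<Rightarrow> bexp \<Rightarrow> state \<Rightarrow> bool" where
  "bval orc (NLess p q) s \<longleftrightarrow> nval p s < nval q s"
| "bval orc (RLess p q) s \<longleftrightarrow> rval orc p s < rval orc q s"
| "bval orc (BNot b) s \<longleftrightarrow> \<not> bval orc b s"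
| "bval orc (BAnd b c) s \<longleftrightarrow> bval orc b s \<and> bval orc c s"
| "bval orc (Indep x l) s \<longleftrightarrow> indep_oracle orc (nats s x ` {..<nval l s})"

text \<open>Evaluating an expression costs one time unit per constant, memory access, arithmetic or
  Boolean operation, comparison and oracle call occurring in it.\<close>

primrec ncost :: "nexp \<Rightarrow> nat" where
  "ncost (N m) = 1"
| "ncost (NArr x i) = 1 + ncost i"
| "ncost (NAdd p q) = 1 + ncost p + ncost q"
| "ncost (NSub p q) = 1 + ncost p + ncost q"

primrec rcost :: "rexp \<Rightarrow> nat" where
  "rcost RZero = 1"
| "rcost (RArr x i) = 1 + ncost i"
| "rcost (RAdd p q) = 1 + rcost p + rcost q"
| "rcost (RSub p q) = 1 + rcost p + rcost q"
| "rcost (Dist i j) = 1 + ncost i + ncost j"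

primrec bcost :: "bexp \<Rightarrow> nat" where
  "bcost (NLess p q) = 1 + ncost p + ncost q"
| "bcost (RLess p q) = 1 + rcost p + rcost q"
| "bcost (BNot b) = 1 + bcost b"
| "bcost (BAnd b c) = 1 + bcost b + bcost c"
| "bcost (Indep x l) = 1 + ncost l"

definition nupd :: "vname \<Rightarrow> nat \<Rightarrow> nat \<Rightarrow> state \<Rightarrow> state" where
  "nupd x i v s = s\<lparr>nats := (nats s)(x := (nats s x)(i := v))\<rparr>"

definition rupd :: "vname \<Rightarrow> nat \<Rightarrow> real \<Rightarrow> state \<Rightarrow> state" where
  "rupd x i v s = s\<lparr>reals := (reals s)(x := (reals s x)(i := v))\<rparr>"

text \<open>\<open>exec orc c s t s'\<close>: started in state \<open>s\<close>, the program \<open>c\<close> terminates in state \<open>s'\<close>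
  after \<open>t\<close> time units.\<close>

inductive exec :: "oracles \<Rightarrow> com \<Rightarrow> state \<Rightarrow> nat \<Rightarrow> state \<Rightarrow> bool" for orc where
  Skip: "exec orc Skip s 1 s"
| NAssign: "exec orc (NAssign x i p) s (1 + ncost i + ncost p) (nupd x (nval i s) (nval p s) s)"
| RAssign: "exec orc (RAssign x i p) s (1 + ncost i + rcost p) (rupd x (nval i s) (rval orc p s) s)"
| Seq: "exec orc c1 s1 t1 s2 \<Longrightarrow> exec orc c2 s2 t2 s3 \<Longrightarrow>
    exec orc (Seq c1 c2) s1 (t1 + t2) s3"
| IfTrue: "bval orc b s \<Longrightarrow> exec orc c1 s t s' \<Longrightarrow>
    exec orc (Cond b c1 c2) s (1 + bcost b + t) s'"
| IfFalse: "\<not> bval orc b s \<Longrightarrow> exec orc c2 s t s' \<Longrightarrow>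
    exec orc (Cond b c1 c2) s (1 + bcost b + t) s'"
| WhileFalse: "\<not> bval orc b s \<Longrightarrow> exec orc (While b c) s (1 + bcost b) s"
| WhileTrue: "bval orc b s1 \<Longrightarrow> exec orc c s1 t1 s2 \<Longrightarrow> exec orc (While b c) s2 t2 s3 \<Longrightarrow>
    exec orc (While b c) s1 (1 + bcost b + t1 + t2) s3"

inductive_cases SkipE: "exec orc Skip s t s'"
inductive_cases NAssignE: "exec orc (NAssign x i p) s t s'"
inductive_cases RAssignE: "exec orc (RAssign x i p) s t s'"
inductive_cases SeqE: "exec orc (Seq c1 c2) s t s'"
inductive_cases IfE: "exec orc (Cond b c1 c2) s t s'"
inductive_cases WhileE: "exec orc (While b c) s t s'"

lemma exec_deterministic:
  "exec orc c s t s' \<Longrightarrow> exec orc c s u s'' \<Longrightarrow> u = t \<and> s'' = s'"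
proof (induction arbitrary: u s'' rule: exec.induct)
  case (Skip s)
  then show ?case by (rule SkipE) simp
next
  case (NAssign x i p s)
  then show ?case by (rule NAssignE) simp
next
  case (RAssign x i p s)
  then show ?case by (rule RAssignE) simp
next
  case (Seq c1 s1 t1 s2 c2 t2 s3)
  from Seq.prems obtain u1 v u2 where
    1: "exec orc c1 s1 u1 v" and 2: "exec orc c2 v u2 s''" and u: "u = u1 + u2"
    by (rule SeqE)
  from Seq.IH(1)[OF 1] have v: "u1 = t1" "v = s2" by simp_all
  from Seq.IH(2)[OF 2[unfolded v]] v u show ?case by simp
next
  case (IfTrue b s c1 t s' c2)
  from IfTrue.prems obtain u1 where
    1: "exec orc c1 s u1 s''" and u: "u = 1 + bcost b + u1"
    by (rule IfE) (simp_all add: IfTrue.hyps(1))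
  from IfTrue.IH[OF 1] u show ?case by simp
next
  case (IfFalse b s c2 t s' c1)
  from IfFalse.prems obtain u1 where
    1: "exec orc c2 s u1 s''" and u: "u = 1 + bcost b + u1"
    by (rule IfE) (simp_all add: IfFalse.hyps(1))
  from IfFalse.IH[OF 1] u show ?case by simp
next
  case (WhileFalse b s c)
  from WhileFalse.prems show ?case
    by (rule WhileE) (simp_all add: WhileFalse.hyps(1))
next
  case (WhileTrue b s1 c t1 s2 t2 s3)
  from WhileTrue.prems obtain u1 v u2 where
    1: "exec orc c s1 u1 v" and 2: "exec orc (While b c) v u2 s''"
    and u: "u = 1 + bcost b + u1 + u2"
    by (rule WhileE) (simp_all add: WhileTrue.hyps(1))
  from WhileTrue.IH(1)[OF 1] have v: "u1 = t1" "v = s2" by simp_all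
  from WhileTrue.IH(2)[OF 2[unfolded v]] v u show ?case by simp
qed

text \<open>Input and output conventions: initially the memory is zero except that the scalar \<open>n\<close>
  holds the size of the ground set.  The result is the set of elements listed in the first
  \<open>size\<close> entries of the array \<open>A\<close>.  In particular, the rank is not part of the input.\<close>

definition input_state :: "nat \<Rightarrow> state" where
  "input_state n = \<lparr>nats = (\<lambda>x i. if x = ''n'' \<and> i = 0 then n else 0), reals = (\<lambda>x i. 0)\<rparr>"

definition output_set :: "state \<Rightarrow> nat set" where
  "output_set s = nats s ''A'' ` {..<nats s ''size'' 0}"

text \<open>The oracles of an instance whose ground set is enumerated by \<open>e\<close> on \<open>{..<n}\<close>.
  Names outside this range carry no information.  Since programs only see names, the type
  \<open>'a\<close> of the elements does not occur in the type of programs.\<close>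

definition instance_oracles ::
    "nat \<Rightarrow> (nat \<Rightarrow> 'a) \<Rightarrow> ('a \<Rightarrow> 'a \<Rightarrow> real) \<Rightarrow> 'a set set \<Rightarrow> oracles" where
  "instance_oracles n e d \<I> =
     \<lparr>dist_oracle = (\<lambda>i j. if i < n \<and> j < n then d (e i) (e j) else 0),
      indep_oracle = (\<lambda>S. S \<subseteq> {..<n} \<and> e ` S \<in> \<I>)\<rparr>"

text \<open>\<open>returns c n e d \<I> t A\<close>: on the given instance, the program \<open>c\<close> terminates after \<open>t\<close> time
  units and returns the set \<open>A\<close>.\<close>

definition returns ::
    "com \<Rightarrow> nat \<Rightarrow> (nat \<Rightarrow> 'a) \<Rightarrow> ('a \<Rightarrow> 'a \<Rightarrow> real) \<Rightarrow> 'a set set \<Rightarrow> nat \<Rightarrow> 'a set \<Rightarrow> bool" where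
  "returns c n e d \<I> t A \<longleftrightarrow>
     (\<exists>s. exec (instance_oracles n e d \<I>) c (input_state n) t s \<and>
          output_set s \<subseteq> {..<n} \<and> A = e ` output_set s)"

end

theory Submission
  imports Defs
begin

text \<open>
  Best-improvement local search from an arbitrary basis.  Given a basis \<open>A\<close> and an optimal basis
  \<open>B\<close>, Brualdi's bijection \<open>p\<close> yields swaps \<open>a \<leadsto> p a\<close> whose gains sum up to
  \<open>d(A, B) - 2 d(A) - (\<Sum>a. d a (p a))\<close>.  Negative type, applied to \<open>1\<^sub>A - 1\<^sub>B\<close> and to the
  differences of \<open>1\<^sub>a + 1\<^bsub>p a\<^esub>\<close> and \<open>(1\<^sub>A + 1\<^sub>B) / k\<close>, bounds this below by
  \<open>(1 - 2/k) d(B) - (1 + 2/k) d(A)\<close>.  Hence the best swap shrinks the gap between \<open>d(A)\<close> and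
  \<open>(k - 2)/(k + 2) d(B)\<close> by a factor \<open>1 - 1/k\<close>, and after \<open>k \<lceil>log 2 k\<rceil>\<close> rounds the remaining
  relative gap is at most \<open>1/k\<close>.  If the sums \<open>d(A, x)\<close> are maintained, a round takes
  \<open>O(nk)\<close> time.
\<close>

section \<open>Distances of negative type\<close>

text \<open>The obstacle is the loss \<open>d a (p a)\<close> in every swap: the distances from the
  incoming element \<open>p a\<close> to the old set include the one to the outgoing
  \<open>a\<close>. Local optimality says nothing about this term, and for a single pair it may be
  large; only its sum over a whole matching is controlled, by about a \<open>1/k\<close> share of
  the total dispersion. This is why a bijection between the two bases is required. The contraction
  needs no good starting set: nonnegativity of the dispersion is the only information used about the
  initial basis. The constant 5 is 4 + 1: the factor \<open>(k - 2)/(k + 2)\<close> costs about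
  \<open>4/k\<close>, stopping after finitely many rounds costs \<open>1/k\<close>. The number of
  rounds is fixed beforehand, so no approximate optimality test is performed; at a local optimum the
  remaining rounds are idle. Since the rank is not an input and the machine neither multiplies nor
  takes logarithms, \<open>k\<close> comes from a greedy basis, its logarithm from doubling, and the
  product from nested loops.\<close>

definition cross :: "('a \<Rightarrow> 'a \<Rightarrow> real) \<Rightarrow> 'a set \<Rightarrow> 'a set \<Rightarrow> real" where
  "cross d A B = (\<Sum>a\<in>A. \<Sum>b\<in>B. d a b)"

lemma dispersion_empty [simp]: "dispersion d {} = 0"
proof -
  have "{P. P \<subseteq> {} \<and> card P = 2} = ({} :: 'a set set)" by auto
  then show ?thesis unfolding dispersion_def by (simp only: sum.empty)
qed

lemma distance_on_subset: "distance_on X d \<Longrightarrow> A \<subseteq> X \<Longrightarrow> distance_on A d"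
  unfolding distance_on_def by blast

lemma cross_commute: "distance_on X d \<Longrightarrow> A \<subseteq> X \<Longrightarrow> B \<subseteq> X \<Longrightarrow> cross d A B = cross d B A"
  unfolding cross_def distance_on_def
  by (subst sum.swap) (auto intro!: sum.cong)

text \<open>Passing to ordered pairs counts every unordered pair twice, and the diagonal vanishes.
  Most estimates of \<open>dispersion\<close> go through this form.\<close>

lemma two_dispersion_eq_cross:
  assumes "finite A" "distance_on A d"
  shows "2 * dispersion d A = cross d A A"
  using assms
proof (induction A rule: finite_induct)
  case empty
  then show ?case by (simp add: cross_def)
next
  case (insert b A)
  have A: "distance_on A d"
    using insert.prems by (rule distance_on_subset) blast
  have sym: "d a b = d b a" if "a \<in> A" for a
    using insert.prems that unfolding distance_on_def by blast
  have "d b b = 0" using insert.prems unfolding distance_on_def by blast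
  then have "cross d (insert b A) (insert b A) = cross d A A + (\<Sum>a\<in>A. d b a) + (\<Sum>a\<in>A. d a b)"
    using insert.hyps by (simp add: cross_def sum.distrib)
  also have "(\<Sum>a\<in>A. d b a) = (\<Sum>a\<in>A. d a b)"
    using sym by (intro sum.cong) auto
  finally show ?case
    using insert.IH[OF A] dispersion_insert[OF insert.hyps, of d] sym by simp
qed

lemma dispersion_nonneg:
  assumes "finite A" "distance_on A d"
  shows "0 \<le> dispersion d A"
proof -
  have "0 \<le> cross d A A"
    using assms(2) unfolding cross_def distance_on_def by (intro sum_nonneg) auto
  with two_dispersion_eq_cross[OF assms] show ?thesis by simp
qed

lemma dispersion_mono:
  assumes "finite B" "distance_on B d" "A \<subseteq> B"
  shows "dispersion d A \<le> dispersion d B"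
proof -
  have A: "finite A" "distance_on A d"
    using assms finite_subset distance_on_subset by blast+
  have "cross d A A \<le> (\<Sum>a\<in>A. \<Sum>b\<in>B. d a b)"
    using assms A unfolding cross_def distance_on_def by (intro sum_mono sum_mono2) blast+
  also have "\<dots> \<le> cross d B B"
    using assms A unfolding cross_def distance_on_def by (intro sum_mono2 sum_nonneg) blast+
  finally show ?thesis
    using two_dispersion_eq_cross[OF A] two_dispersion_eq_cross[OF assms(1,2)] by simp
qed

lemma dispersion_image:
  assumes fin: "finite A" and inj: "inj_on e A" and dist: "distance_on (e ` A) d"
    and d': "\<And>i j. i \<in> A \<Longrightarrow> j \<in> A \<Longrightarrow> d' i j = d (e i) (e j)"
  shows "dispersion d (e ` A) = dispersion d' A"
proof -
  have "distance_on A d'"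
    using dist d' unfolding distance_on_def by simp
  moreover have "cross d (e ` A) (e ` A) = cross d' A A"
    using inj d' by (simp add: cross_def sum.reindex)
  ultimately show ?thesis
    using two_dispersion_eq_cross[of "e ` A" d] two_dispersion_eq_cross[of A d'] fin dist by simp
qed

text \<open>Both sums run over all of \<open>A\<close>, including \<open>a\<close>, so that they can
  be read from the maintained array of sums; hence the correction \<open>d a b\<close>. For
  \<open>b = a\<close> the value is \<open>- d a a\<close>, which is 0 for a distance
  function.\<close>

definition swap_gain :: "('a \<Rightarrow> 'a \<Rightarrow> real) \<Rightarrow> 'a set \<Rightarrow> 'a \<Rightarrow> 'a \<Rightarrow> real" where
  "swap_gain d A a b = (\<Sum>x\<in>A. d x b) - d a b - (\<Sum>x\<in>A. d x a)"

lemma dispersion_swap: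
  assumes "finite X" "distance_on X d" "A \<subseteq> X" "a \<in> A" "b \<in> X - A"
  shows "dispersion d (insert b (A - {a})) = dispersion d A + swap_gain d A a b"
proof -
  have fin: "finite A" using assms finite_subset by blast
  have sym: "d x y = d y x" if "x \<in> X" "y \<in> X" for x y
    using assms(2) that unfolding distance_on_def by blast
  have "dispersion d (insert b (A - {a})) = dispersion d (A - {a}) + (\<Sum>x\<in>A - {a}. d x b)"
    using assms fin by (intro dispersion_insert sym) auto
  moreover have "dispersion d (insert a (A - {a})) = dispersion d (A - {a}) + (\<Sum>x\<in>A - {a}. d x a)"
    using assms fin by (intro dispersion_insert sym) auto
  moreover have "d a a = 0" using assms unfolding distance_on_def by blast
  moreover have "insert a (A - {a}) = A" using assms by blast
  ultimately show ?thesis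
    using fin assms(4) by (simp add: swap_gain_def sum_diff1)
qed

text \<open>Polar form of the quadratic form in \<open>negative_type\<close>: test vectors that
  combine indicator functions are expanded by linearity into \<open>cross\<close> terms.\<close>

definition bilin :: "'a set \<Rightarrow> ('a \<Rightarrow> 'a \<Rightarrow> real) \<Rightarrow> ('a \<Rightarrow> real) \<Rightarrow> ('a \<Rightarrow> real) \<Rightarrow> real" where
  "bilin X d f g = (\<Sum>a\<in>X. \<Sum>b\<in>X. f a * d a b * g b)"

lemma bilin_add_left: "bilin X d (\<lambda>a. f a + g a) h = bilin X d f h + bilin X d g h"
  by (simp add: bilin_def algebra_simps sum.distrib)

lemma bilin_add_right: "bilin X d h (\<lambda>a. f a + g a) = bilin X d h f + bilin X d h g"
  by (simp add: bilin_def algebra_simps sum.distrib)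

lemma bilin_diff_left: "bilin X d (\<lambda>a. f a - g a) h = bilin X d f h - bilin X d g h"
  by (simp add: bilin_def algebra_simps sum_subtractf)

lemma bilin_diff_right: "bilin X d h (\<lambda>a. f a - g a) = bilin X d h f - bilin X d h g"
  by (simp add: bilin_def algebra_simps sum_subtractf)

lemma bilin_scale_left: "bilin X d (\<lambda>a. c * f a) h = c * bilin X d f h"
  by (simp add: bilin_def algebra_simps sum_distrib_left)

lemma bilin_scale_right: "bilin X d h (\<lambda>a. c * f a) = c * bilin X d h f"
  by (simp add: bilin_def algebra_simps sum_distrib_left)

lemmas bilin_linear = bilin_add_left bilin_add_right bilin_diff_left bilin_diff_right
  bilin_scale_left bilin_scale_right

lemma bilin_of_bool:
  assumes "finite X" "A \<subseteq> X" "B \<subseteq> X"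
  shows "bilin X d (\<lambda>a. of_bool (a \<in> A)) (\<lambda>a. of_bool (a \<in> B)) = cross d A B"
proof -
  have "X \<inter> {x. x \<in> A} = A" "X \<inter> {x. x \<in> B} = B" using assms by auto
  with assms(1) show ?thesis
    by (simp add: bilin_def cross_def mult.assoc flip: sum_distrib_left)
qed

lemma sum_of_bool_mem:
  assumes "finite X" "A \<subseteq> X"
  shows "(\<Sum>a\<in>X. of_bool (a \<in> A)) = real (card A)"
proof -
  have "X \<inter> {x. x \<in> A} = A" using assms by auto
  with assms show ?thesis by simp
qed

lemma negative_type_bilin:
  "negative_type X d \<Longrightarrow> (\<Sum>a\<in>X. f a) = 0 \<Longrightarrow> bilin X d f f \<le> 0"
  by (simp add: negative_type_def bilin_def)

lemma cross_ge_dispersion: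
  assumes "finite X" "distance_on X d" "negative_type X d"
    and "A \<subseteq> X" "B \<subseteq> X" "card A = card B"
  shows "dispersion d A + dispersion d B \<le> cross d A B"
proof -
  let ?f = "\<lambda>A a. of_bool (a \<in> A) :: real"
  have "(\<Sum>a\<in>X. ?f A a - ?f B a) = 0"
    using assms unfolding sum_subtractf by (simp only: sum_of_bool_mem)
  from negative_type_bilin[OF assms(3) this]
  have "cross d A A - cross d B A - (cross d A B - cross d B B) \<le> 0"
    using assms by (simp only: bilin_linear bilin_of_bool)
  moreover have "2 * dispersion d A = cross d A A" "2 * dispersion d B = cross d B B"
    using assms by (metis finite_subset distance_on_subset two_dispersion_eq_cross)+
  ultimately show ?thesis
    using cross_commute[OF assms(2,4,5)] by simp
qed

text \<open>In a Euclidean embedding of \<open>sqrt d\<close>, this is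
  the parallelogram law around the common centroid of \<open>A\<close> and \<open>B\<close>.\<close>

lemma sum_matching_le:
  assumes X: "finite X" "distance_on X d" "negative_type X d"
    and sub: "A \<subseteq> X" "B \<subseteq> X" and p: "bij_betw p A B"
  shows "real (card A) * (\<Sum>a\<in>A. d a (p a)) \<le> dispersion d A + dispersion d B + cross d A B"
proof (cases "A = {}")
  case True
  with p have "B = {}" by (simp add: bij_betw_def)
  with True show ?thesis by (simp add: cross_def)
next
  case False
  define k where "k = real (card A)"
  have "finite A" using X sub finite_subset by blast
  with False have k: "k > 0" by (simp add: k_def card_gt_0_iff)
  have cardB: "real (card B) = k" using p by (simp add: k_def bij_betw_same_card)
  have disp: "cross d A A = 2 * dispersion d A" "cross d B B = 2 * dispersion d B"
    using X sub by (metis finite_subset distance_on_subset two_dispersion_eq_cross)+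
  have comm: "cross d B A = cross d A B" using cross_commute[OF X(2) sub] by simp
  let ?f = "\<lambda>A a. of_bool (a \<in> A) :: real"
  let ?W = "dispersion d A + dispersion d B + cross d A B"
  let ?r = "\<lambda>x. cross d {x} A + cross d {x} B"
  \<comment> \<open>Test vector: indicators of \<open>a\<close> and \<open>b\<close> minus
    \<open>1/k\<close> times those of \<open>A\<close> and \<open>B\<close>; its entries sum to 2 -
    2 = 0. The case \<open>a = b\<close> is included, since then \<open>d a b = 0\<close>.\<close>
  have ineq: "2 * d a b - (2 / k) * (?r a + ?r b) + (2 / k\<^sup>2) * ?W \<le> 0"
    if ab: "a \<in> A" "b \<in> B" for a b
  proof -
    have sing: "{a} \<subseteq> X" "{b} \<subseteq> X" using ab sub by auto
    have d: "cross d {a} {a} = 0" "cross d {b} {b} = 0" "cross d {b} {a} = cross d {a} {b}"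
      "cross d {a} {b} = d a b"
      using X(2) sing by (auto simp: cross_def distance_on_def)
    have c: "cross d A {a} = cross d {a} A" "cross d A {b} = cross d {b} A"
      "cross d B {a} = cross d {a} B" "cross d B {b} = cross d {b} B"
      using X(2) sub sing by (metis cross_commute)+
    have "(\<Sum>x\<in>X. (?f {a} x + ?f {b} x) - (1 / k) * (?f A x + ?f B x))
        = 1 + 1 - (1 / k) * (k + k)"
      using X sub sing cardB
      unfolding sum_subtractf sum.distrib sum_distrib_left[symmetric]
      by (simp only: sum_of_bool_mem k_def) simp
    also have "\<dots> = 0" using k by simp
    finally have "bilin X d (\<lambda>x. (?f {a} x + ?f {b} x) - (1 / k) * (?f A x + ?f B x))
        (\<lambda>x. (?f {a} x + ?f {b} x) - (1 / k) * (?f A x + ?f B x)) \<le> 0"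
      by (rule negative_type_bilin[OF X(3)])
    then have "2 * d a b - (2 / k) * (?r a + ?r b) + (1 / k) * ((1 / k) * (2 * ?W)) \<le> 0"
      using X sub sing
      unfolding bilin_linear
      by (simp only: bilin_of_bool d c disp comm) (simp add: algebra_simps)
    then show ?thesis by (simp add: power2_eq_square)
  qed
  have row: "(\<Sum>x\<in>S. ?r x) = cross d S A + cross d S B" for S
    by (simp add: cross_def sum.distrib)
  have total: "cross d A A + cross d A B + (cross d B A + cross d B B) = 2 * ?W"
    by (simp add: disp comm)
  have lin: "(\<Sum>a\<in>A. 2 * u a - c * v a + w) = 2 * (\<Sum>a\<in>A. u a) - c * (\<Sum>a\<in>A. v a) + k * w"
    for u v :: "'a \<Rightarrow> real" and c w
    by (simp add: sum.distrib sum_subtractf sum_distrib_left k_def)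
  \<comment> \<open>Along the matching, the row sums over \<open>A\<close> and over its image
    \<open>B\<close> add up to \<open>2 * ?W\<close>, and the constant terms to
    \<open>(2 / k) * ?W\<close>. What remains is that the matching weighs at most
    \<open>?W / k\<close>.\<close>
  have "(\<Sum>a\<in>A. 2 * d a (p a) - (2 / k) * (?r a + ?r (p a)) + (2 / k\<^sup>2) * ?W) \<le> 0"
    using ineq bij_betwE[OF p] by (intro sum_nonpos) auto
  also have "(\<Sum>a\<in>A. 2 * d a (p a) - (2 / k) * (?r a + ?r (p a)) + (2 / k\<^sup>2) * ?W)
      = 2 * (\<Sum>a\<in>A. d a (p a)) - (2 / k) * ((\<Sum>a\<in>A. ?r a) + (\<Sum>a\<in>A. ?r (p a)))
        + k * ((2 / k\<^sup>2) * ?W)"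
    by (subst lin) (simp only: sum.distrib)
  also have "(\<Sum>a\<in>A. ?r (p a)) = (\<Sum>b\<in>B. ?r b)"
    by (rule sum.reindex_bij_betw[OF p])
  finally have "2 * (\<Sum>a\<in>A. d a (p a)) - (2 / k) * (2 * ?W) + k * ((2 / k\<^sup>2) * ?W) \<le> 0"
    unfolding row total .
  moreover have "k * ((2 / k\<^sup>2) * w) = (2 / k) * w" for w
    using k by (simp add: power2_eq_square)
  ultimately have "2 * (\<Sum>a\<in>A. d a (p a)) - (2 / k) * (2 * ?W) + (2 / k) * ?W \<le> 0"
    by (simp only:)
  moreover have "k * x \<le> w" if "2 * x - (2 / k) * (2 * w) + (2 / k) * w \<le> 0" for x w
    using that k by (simp add: field_simps)
  ultimately show ?thesis unfolding k_def by blast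
qed

section \<open>Matroids\<close>

context matroid
begin

lemma finite_indep: "S \<in> \<I> \<Longrightarrow> finite S"
  using indep_subset finite_ground finite_subset by blast

lemma finite_family: "finite \<I>"
  using indep_subset finite_ground by (meson Pow_iff finite_Pow_iff finite_subset subsetI)

lemma card_le_rank: "S \<in> \<I> \<Longrightarrow> card S \<le> matroid_rank \<I>"
  unfolding matroid_rank_def using finite_family by simp

lemma ex_card_eq_rank: "\<exists>S\<in>\<I>. card S = matroid_rank \<I>"
  using Max_in[of "card ` \<I>"] finite_family empty_indep unfolding matroid_rank_def by fastforce

text \<open>Iterated exchange. The inclusion in \<open>S \<union> T\<close> is what
  \<open>symmetric_exchange\<close> exploits.\<close>

lemma extend_indep:
  assumes "S \<in> \<I>" "T \<in> \<I>" "card S \<le> card T"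
  shows "\<exists>K\<in>\<I>. S \<subseteq> K \<and> K \<subseteq> S \<union> T \<and> card K = card T"
  using assms
proof (induction "card T - card S" arbitrary: S)
  case 0
  then show ?case by (intro bexI[of _ S]) auto
next
  case (Suc m)
  then obtain a where a: "a \<in> T - S" "insert a S \<in> \<I>"
    using exchange[of S T] by (metis diff_is_0_eq' nat.distinct(1) not_le)
  then have "card (insert a S) = Suc (card S)"
    using finite_indep[OF Suc.prems(1)] by simp
  then have "m = card T - card (insert a S)" "card (insert a S) \<le> card T"
    using Suc.hyps(2) by linarith+
  from Suc.hyps(1)[OF this(1) a(2) Suc.prems(2) this(2)]
  obtain K where "K \<in> \<I>" "insert a S \<subseteq> K" "K \<subseteq> insert a S \<union> T" "card K = card T" by blast
  with a show ?case by blast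
qed

lemma extend_to_basis: "S \<in> \<I> \<Longrightarrow> \<exists>B\<in>\<I>. S \<subseteq> B \<and> card B = matroid_rank \<I>"
  using extend_indep ex_card_eq_rank card_le_rank by metis

lemma card_maximal_indep:
  assumes "S \<in> \<I>" "\<And>x. x \<in> X - S \<Longrightarrow> insert x S \<notin> \<I>"
  shows "card S = matroid_rank \<I>"
  using assms exchange[of S] ex_card_eq_rank card_le_rank indep_subset
  by (metis DiffD1 DiffD2 DiffI le_neq_implies_less subsetD)

text \<open>If no element of \<open>C\<close> could join \<open>A - {a}\<close>, then
  \<open>A - {a}\<close> would be a largest independent subset of
  \<open>C \<union> (A - {a})\<close>. Extending \<open>C\<close> to that size inside this union and
  then once more by an element of \<open>A\<close> can only add \<open>a\<close>, so
  \<open>insert a C\<close> would be independent, against the role of \<open>C\<close>.\<close>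

lemma symmetric_exchange:
  assumes A: "A \<in> \<I>" and B: "B \<in> \<I>" and card: "card A = card B" and a: "a \<in> A - B"
  obtains b where "b \<in> B - A" "insert b (A - {a}) \<in> \<I>" "insert a (B - {b}) \<in> \<I>"
proof -
  \<comment> \<open>\<open>insert a C\<close> is the fundamental circuit of \<open>a\<close> in \<open>B\<close>.\<close>
  define C where "C = {b \<in> B. insert a (B - {b}) \<in> \<I>}"
  have fin: "finite A" "finite B" using A B finite_indep by auto
  have cardA: "card A = Suc (card (A - {a}))" using fin a by (metis DiffD1 card_Suc_Diff1)
  have indA: "A - {a} \<in> \<I>" using A hereditary by blast
  have C: "C \<in> \<I>" using B by (rule hereditary) (auto simp: C_def)
  have "\<exists>b\<in>C - (A - {a}). insert b (A - {a}) \<in> \<I>"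
  proof (rule ccontr)
    assume none: "\<not> ?thesis"
    have small: "card J \<le> card (A - {a})" if "J \<in> \<I>" "J \<subseteq> C \<union> (A - {a})" for J
      using exchange[OF indA that(1)] that(2) none by (meson DiffD1 DiffD2 DiffI UnE not_less subsetD)
    obtain J where J: "J \<in> \<I>" "C \<subseteq> J" "J \<subseteq> C \<union> (A - {a})" "card J = card (A - {a})"
      using extend_indep[OF C indA small[OF C]] by auto
    obtain x where x: "x \<in> A - J" "insert x J \<in> \<I>"
      using exchange[OF J(1) A] J(4) cardA by auto
    \<comment> \<open>Any other \<open>x\<close> lies in \<open>A - {a}\<close> and would give a set
      too large for \<open>small\<close>.\<close>
    have "x = a"
    proof (rule ccontr)
      assume "x \<noteq> a"
      then have "card (insert x J) \<le> card (A - {a})" using x J by (intro small) auto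
      then show False using x J finite_indep[OF J(1)] by simp
    qed
    then have aC: "insert a C \<in> \<I>" using x J by (intro hereditary[OF x(2)]) auto
    have "card (insert a C) \<le> card B"
    proof -
      have "card (insert a C) \<le> card (insert x J)"
        using J x finite_indep \<open>x = a\<close> by (intro card_mono) auto
      also have "\<dots> = card B" using x J finite_indep[OF J(1)] cardA card by simp
      finally show ?thesis .
    qed
    then obtain K where K: "K \<in> \<I>" "insert a C \<subseteq> K" "K \<subseteq> insert a C \<union> B" "card K = card B"
      using extend_indep[OF aC B] by auto
    \<comment> \<open>\<open>K\<close> has the size of \<open>B\<close> but contains
      \<open>a\<close>, so it misses some \<open>y\<close> in \<open>B\<close> and equals
      \<open>insert a (B - {y})\<close>. That puts \<open>y\<close> into \<open>C\<close>, hence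
      into \<open>K\<close>.\<close>
    have "\<not> B \<subseteq> K"
      using K a card_subset_eq[OF finite_indep[OF K(1)], of B] by auto
    then obtain y where y: "y \<in> B" "y \<notin> K" by blast
    have sub: "K \<subseteq> insert a (B - {y})" using K y by (auto simp: C_def)
    have "card (insert a (B - {y})) = Suc (card (B - {y}))"
      using a fin by (intro card_insert_disjoint) auto
    also have "\<dots> = card K" using K(4) card_Suc_Diff1[OF fin(2) y(1)] by simp
    finally have "card (insert a (B - {y})) = card K" .
    with sub have "K = insert a (B - {y})" using fin by (intro card_subset_eq) auto
    then have "y \<in> C" using K y by (simp add: C_def)
    with K y show False by blast
  qed
  then obtain b where "b \<in> C" "b \<notin> A - {a}" "insert b (A - {a}) \<in> \<I>" by blast
  with a show thesis by (intro that[of b]) (auto simp: C_def)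
qed

text \<open>Brualdi's exchange theorem.\<close>

lemma exchange_bijection:
  assumes "A \<in> \<I>" "B \<in> \<I>" "card A = card B"
  shows "\<exists>p. bij_betw p A B \<and> (\<forall>a\<in>A. insert (p a) (A - {a}) \<in> \<I> \<and> (p a \<in> A \<longrightarrow> p a = a))"
  using assms
proof (induction "card (A - B)" arbitrary: B)
  case 0
  then have "A \<subseteq> B" using finite_indep by simp
  then have "A = B" using 0 finite_indep by (intro card_subset_eq) auto
  then show ?case using 0 by (intro exI[of _ id]) (auto simp: insert_absorb bij_betw_def)
next
  case (Suc m)
  have fin: "finite A" "finite B" using Suc.prems finite_indep by auto
  obtain a where a: "a \<in> A - B" using Suc.hyps(2) by (metis card.empty ex_in_conv nat.distinct(1))
  obtain b where b: "b \<in> B - A" "insert b (A - {a}) \<in> \<I>" "insert a (B - {b}) \<in> \<I>"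
    using symmetric_exchange[OF Suc.prems a] by blast
  let ?B = "insert a (B - {b})"
  have "A - ?B = (A - B) - {a}" using b by auto
  then have m: "m = card (A - ?B)" using Suc.hyps(2) a fin by simp
  have "card A = card ?B"
    using Suc.prems a b fin card.remove[of B b] by simp
  from Suc.hyps(1)[OF m Suc.prems(1) b(3) this] obtain p where
    p: "bij_betw p A ?B" and ex: "\<And>x. x \<in> A \<Longrightarrow> insert (p x) (A - {x}) \<in> \<I>"
    and fix': "\<And>x. x \<in> A \<Longrightarrow> p x \<in> A \<Longrightarrow> p x = x" by blast
  \<comment> \<open>\<open>a\<close> now belongs to the target and so is hit by some
    \<open>x\<close> in \<open>A\<close>; the fixed-point clause of the induction hypothesis forces
    \<open>x = a\<close>. Redirecting \<open>a\<close> to \<open>b\<close> therefore leaves the rest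
    of the bijection intact.\<close>
  have pa: "p a = a"
    using p a fix' unfolding bij_betw_def by (metis DiffD1 image_iff insertI1)
  have "bij_betw p (A - {a}) (?B - {a})"
    using p pa a by (intro bij_betw_DiffI) auto
  moreover have "?B - {a} = B - {b}" using a by auto
  ultimately have "bij_betw p (A - {a}) (B - {b})" by simp
  then have "bij_betw (p(a := b)) (A - {a}) (B - {b})"
    by (subst bij_betw_cong[of _ _ p]) auto
  moreover have "bij_betw (p(a := b)) {a} {b}" by simp
  ultimately have "bij_betw (p(a := b)) ((A - {a}) \<union> {a}) ((B - {b}) \<union> {b})"
    by (rule bij_betw_combine) auto
  moreover have "(A - {a}) \<union> {a} = A" "(B - {b}) \<union> {b} = B" using a b by auto
  ultimately have "bij_betw (p(a := b)) A B" by simp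
  then show ?case
    using ex fix' b by (intro exI[of _ "p(a := b)"]) auto
qed

lemma dispersion_nonneg_indep:
  assumes "distance_on X d" "S \<in> \<I>"
  shows "0 \<le> dispersion d S"
  using finite_indep[OF assms(2)] distance_on_subset[OF assms(1) indep_subset[OF assms(2)]]
  by (rule dispersion_nonneg)

text \<open>The best gain is at least the average gain along the exchange bijection. Common elements
  of \<open>A\<close> and \<open>B\<close> are fixed points, which are no swaps but contribute 0;
  hence \<open>g\<close> is taken nonnegative.\<close>

lemma best_swap_gain:
  assumes dist: "distance_on X d" "negative_type X d"
    and A: "A \<in> \<I>" and B: "B \<in> \<I>" and card: "card A = k" "card B = k" and "0 < k"
    and g: "0 \<le> g"
      "\<And>a b. a \<in> A \<Longrightarrow> b \<in> X - A \<Longrightarrow> insert b (A - {a}) \<in> \<I> \<Longrightarrow> swap_gain d A a b \<le> g"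
  shows "(1 - 2 / k) * dispersion d B - (1 + 2 / k) * dispersion d A \<le> k * g"
proof -
  have sub: "A \<subseteq> X" "B \<subseteq> X" using A B indep_subset by auto
  have k: "real k > 0" using \<open>0 < k\<close> by simp
  obtain p where p: "bij_betw p A B"
    and ex: "\<And>a. a \<in> A \<Longrightarrow> insert (p a) (A - {a}) \<in> \<I>"
    and fix': "\<And>a. a \<in> A \<Longrightarrow> p a \<in> A \<Longrightarrow> p a = a"
    using exchange_bijection[OF A B] card by metis
  have "swap_gain d A a (p a) \<le> g" if a: "a \<in> A" for a
  proof (cases "p a \<in> A")
    case True
    moreover have "d a a = 0" using dist a sub unfolding distance_on_def by blast
    ultimately show ?thesis using fix'[OF a] g(1) by (simp add: swap_gain_def)
  next
    case False
    then show ?thesis using a ex bij_betwE[OF p] sub by (intro g(2)) auto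
  qed
  then have "(\<Sum>a\<in>A. swap_gain d A a (p a)) \<le> k * g"
    using card sum_bounded_above[of A "\<lambda>a. swap_gain d A a (p a)" g] by simp
  moreover have "(\<Sum>a\<in>A. swap_gain d A a (p a))
      = cross d A B - (\<Sum>a\<in>A. d a (p a)) - 2 * dispersion d A"
  proof -
    have "(\<Sum>a\<in>A. \<Sum>x\<in>A. d x (p a)) = (\<Sum>b\<in>B. \<Sum>x\<in>A. d x b)"
      by (rule sum.reindex_bij_betw[OF p])
    also have "\<dots> = cross d A B" unfolding cross_def by (rule sum.swap)
    finally have 1: "(\<Sum>a\<in>A. \<Sum>x\<in>A. d x (p a)) = cross d A B" .
    have "(\<Sum>a\<in>A. \<Sum>x\<in>A. d x a) = cross d A A" unfolding cross_def by (rule sum.swap)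
    also have "\<dots> = 2 * dispersion d A"
      using two_dispersion_eq_cross[OF finite_indep[OF A] distance_on_subset[OF dist(1) sub(1)]] by simp
    finally show ?thesis using 1 by (simp add: swap_gain_def sum_subtractf)
  qed
  moreover define r where "r = 1 / real k"
  have "(\<Sum>a\<in>A. d a (p a)) \<le> r * (dispersion d A + dispersion d B + cross d A B)"
    using sum_matching_le[OF finite_ground dist sub p] card k by (simp add: field_simps r_def)
  moreover have "dispersion d A + dispersion d B \<le> cross d A B"
    using cross_ge_dispersion[OF finite_ground dist sub] card by simp
  \<comment> \<open>After the matching bound, \<open>cross d A B\<close> has the coefficient
    \<open>1 - r >= 0\<close> and may be replaced by its lower bound. This leaves
    \<open>1 - 2 * r\<close> for \<open>B\<close> and \<open>1 - 2 * r - 2\<close> for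
    \<open>A\<close>.\<close>
  then have "0 \<le> (1 - r) * (cross d A B - (dispersion d A + dispersion d B))"
    using \<open>0 < k\<close> by (intro mult_nonneg_nonneg) (auto simp: r_def)
  ultimately have "(1 - 2 * r) * dispersion d B - (1 + 2 * r) * dispersion d A \<le> k * g"
    by (simp add: algebra_simps)
  then show ?thesis by (simp add: r_def)
qed

end

section \<open>Verification of programs with running times\<close>

definition runs :: "oracles \<Rightarrow> com \<Rightarrow> state \<Rightarrow> (nat \<Rightarrow> state \<Rightarrow> bool) \<Rightarrow> bool" where
  "runs orc c s Q \<longleftrightarrow> (\<exists>t s'. exec orc c s t s' \<and> Q t s')"

lemma runs_weaken:
  "runs orc c s P \<Longrightarrow> (\<And>t s'. P t s' \<Longrightarrow> Q t s') \<Longrightarrow> runs orc c s Q"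
  unfolding runs_def by blast

text \<open>Determinism makes this an equivalence, so basic commands, \<open>Seq\<close> and
  \<open>Cond\<close> become rewrite rules and the simplifier executes straight-line code
  symbolically.\<close>

lemma runs_iff_exec:
  assumes "exec orc c s t s'"
  shows "runs orc c s Q \<longleftrightarrow> Q t s'"
proof
  assume "runs orc c s Q"
  then obtain u s'' where u: "exec orc c s u s''" "Q u s''" unfolding runs_def by blast
  with exec_deterministic[OF assms u(1)] show "Q t s'" by (simp only:)
next
  assume "Q t s'"
  with assms show "runs orc c s Q" unfolding runs_def by blast
qed

lemmas runs_basic [simp] =
  runs_iff_exec[OF exec.Skip] runs_iff_exec[OF exec.NAssign] runs_iff_exec[OF exec.RAssign]

lemma runs_Seq [simp]:
  "runs orc (Seq c1 c2) s Q \<longleftrightarrow> runs orc c1 s (\<lambda>t1 s1. runs orc c2 s1 (\<lambda>t2. Q (t1 + t2)))"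
proof
  assume "runs orc (Seq c1 c2) s Q"
  then obtain t s' where e: "exec orc (Seq c1 c2) s t s'" and q: "Q t s'"
    unfolding runs_def by blast
  from e show "runs orc c1 s (\<lambda>t1 s1. runs orc c2 s1 (\<lambda>t2. Q (t1 + t2)))"
  proof (rule SeqE)
    fix t1 s1 t2
    assume "t = t1 + t2" "exec orc c1 s t1 s1" "exec orc c2 s1 t2 s'"
    with q show ?thesis by (simp add: runs_iff_exec)
  qed
next
  assume "runs orc c1 s (\<lambda>t1 s1. runs orc c2 s1 (\<lambda>t2. Q (t1 + t2)))"
  then obtain t1 s1 t2 s2 where "exec orc c1 s t1 s1" "exec orc c2 s1 t2 s2" and q: "Q (t1 + t2) s2"
    unfolding runs_def by blast
  then have "exec orc (Seq c1 c2) s (t1 + t2) s2" by (intro exec.Seq)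
  with q show "runs orc (Seq c1 c2) s Q" by (simp add: runs_iff_exec)
qed

lemma runs_Cond [simp]:
  "runs orc (Cond b c1 c2) s Q \<longleftrightarrow>
     runs orc (if bval orc b s then c1 else c2) s (\<lambda>t. Q (1 + bcost b + t))"
proof
  assume "runs orc (Cond b c1 c2) s Q"
  then obtain t s' where e: "exec orc (Cond b c1 c2) s t s'" and q: "Q t s'"
    unfolding runs_def by blast
  from e show "runs orc (if bval orc b s then c1 else c2) s (\<lambda>t. Q (1 + bcost b + t))"
    by (rule IfE) (use q in \<open>simp_all add: runs_iff_exec\<close>)
next
  let ?c = "if bval orc b s then c1 else c2"
  assume "runs orc ?c s (\<lambda>t. Q (1 + bcost b + t))"
  then obtain t s' where e: "exec orc ?c s t s'" and q: "Q (1 + bcost b + t) s'"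
    unfolding runs_def by blast
  then have "exec orc (Cond b c1 c2) s (1 + bcost b + t) s'"
    by (cases "bval orc b s") (simp_all only: if_True if_False exec.IfTrue exec.IfFalse simp_thms)
  with q show "runs orc (Cond b c1 c2) s Q" by (simp add: runs_iff_exec)
qed

text \<open>The invariant is indexed by the number of completed iterations, and their total
  \<open>m\<close> is known in advance. This index also serves as the termination measure; the last
  summands pay for the final failing test.\<close>

lemma runs_While:
  assumes init: "I 0 s"
    and step: "\<And>j s. j < m \<Longrightarrow> I j s \<Longrightarrow>
      bval orc b s \<and> runs orc c s (\<lambda>t s'. t \<le> T \<and> I (Suc j) s')"
    and exit: "\<And>s. I m s \<Longrightarrow> \<not> bval orc b s"
  shows "runs orc (While b c) s (\<lambda>t s'. t \<le> m * (T + bcost b + 1) + bcost b + 1 \<and> I m s')"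
proof -
  have "runs orc (While b c) s (\<lambda>t s'. t \<le> (m - j) * (T + bcost b + 1) + bcost b + 1 \<and> I m s')"
    if "j \<le> m" "I j s" for j s
    using that
  proof (induction "m - j" arbitrary: j s)
    case 0
    then have "I m s" by simp
    then show ?case
      unfolding runs_def using exec.WhileFalse[OF exit] by fastforce
  next
    case (Suc l)
    then have "j < m" by simp
    with step Suc.prems obtain t s' where b: "bval orc b s"
      and c: "exec orc c s t s'" "t \<le> T" "I (Suc j) s'"
      unfolding runs_def by meson
    have "l = m - Suc j" using Suc.hyps(2) by simp
    from Suc.hyps(1)[OF this _ c(3)] \<open>j < m\<close> obtain t' s'' where
      w: "exec orc (While b c) s' t' s''" "t' \<le> (m - Suc j) * (T + bcost b + 1) + bcost b + 1" "I m s''"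
      unfolding runs_def by auto
    have "m - j = Suc (m - Suc j)" using \<open>j < m\<close> by simp
    then have "1 + bcost b + t + t' \<le> (m - j) * (T + bcost b + 1) + bcost b + 1"
      using c w by simp
    with exec.WhileTrue[OF b c(1) w(1)] w(3) show ?case
      unfolding runs_def by blast
  qed
  from this[of 0 s] init show ?thesis by simp
qed

lemma state_upd_simps [simp]:
  "nats (nupd x i v s) = (nats s)(x := (nats s x)(i := v))"
  "reals (nupd x i v s) = reals s"
  "nats (rupd x i r s) = nats s"
  "reals (rupd x i r s) = (reals s)(x := (reals s x)(i := r))"
  by (simp_all add: nupd_def rupd_def)

section \<open>The local search program\<close>

abbreviation nvar :: "vname \<Rightarrow> nexp" where "nvar x \<equiv> NArr x (N 0)"
abbreviation rvar :: "vname \<Rightarrow> rexp" where "rvar x \<equiv> RArr x (N 0)"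
abbreviation nset :: "vname \<Rightarrow> nexp \<Rightarrow> com" where "nset x p \<equiv> NAssign x (N 0) p"
abbreviation rset :: "vname \<Rightarrow> rexp \<Rightarrow> com" where "rset x p \<equiv> RAssign x (N 0) p"
abbreviation incr :: "vname \<Rightarrow> com" where "incr x \<equiv> nset x (NAdd (nvar x) (N 1))"
abbreviation below :: "vname \<Rightarrow> vname \<Rightarrow> bexp" where "below x y \<equiv> NLess (nvar x) (nvar y)"

text \<open>Array \<open>M\<close> is the characteristic function of the current basis \<open>A\<close>, and \<open>S\<close> holds
  the sums_ok of the distances from each element to \<open>A\<close>.\<close>

definition greedy :: com where
  "greedy = While (below ''b'' ''n'')
     (Seq (NAssign ''A'' (nvar ''size'') (nvar ''b''))
     (Seq (Cond (Indep ''A'' (NAdd (nvar ''size'') (N 1)))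
            (Seq (NAssign ''M'' (nvar ''b'') (N 1)) (incr ''size'')) Skip)
        (incr ''b'')))"

definition sum_row :: com where
  "sum_row = While (below ''i'' ''size'')
     (Seq (RAssign ''S'' (nvar ''b'')
            (RAdd (RArr ''S'' (nvar ''b'')) (Dist (NArr ''A'' (nvar ''i'')) (nvar ''b''))))
        (incr ''i''))"

definition sum_rows :: com where
  "sum_rows = While (below ''b'' ''n'') (Seq (nset ''i'' (N 0)) (Seq sum_row (incr ''b'')))"

text \<open>Doubling by addition: started from \<open>w = 1\<close> and \<open>L = 0\<close>, the
  counter \<open>L\<close> ends as the logarithm of \<open>size\<close> to base 2, rounded
  up.\<close>

definition log_loop :: com where
  "log_loop = While (below ''w'' ''size'')
     (Seq (nset ''w'' (NAdd (nvar ''w'') (nvar ''w''))) (incr ''L''))"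

definition gain_exp :: rexp where
  "gain_exp = RSub (RSub (RArr ''S'' (nvar ''b'')) (Dist (nvar ''o'') (nvar ''b'')))
     (RArr ''S'' (nvar ''o''))"

text \<open>Swapping in place keeps the cost of preparing an independence query constant.\<close>

definition try_swap :: com where
  "try_swap =
     Seq (nset ''o'' (NArr ''A'' (nvar ''i'')))
    (Seq (NAssign ''A'' (nvar ''i'') (nvar ''b''))
    (Seq (Cond (BAnd (NLess (NArr ''M'' (nvar ''b'')) (N 1))
                 (BAnd (Indep ''A'' (nvar ''size'')) (RLess (rvar ''g'') gain_exp)))
           (Seq (rset ''g'' gain_exp) (Seq (nset ''p'' (nvar ''i'')) (nset ''q'' (nvar ''b''))))
           Skip)
    (Seq (NAssign ''A'' (nvar ''i'') (nvar ''o''))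
       (incr ''i''))))"

definition search_row :: com where
  "search_row = While (below ''i'' ''size'') try_swap"

definition search :: com where
  "search = While (below ''b'' ''n'') (Seq (nset ''i'' (N 0)) (Seq search_row (incr ''b'')))"

definition update_sums :: com where
  "update_sums = While (below ''b'' ''n'')
     (Seq (RAssign ''S'' (nvar ''b'') (RAdd (RArr ''S'' (nvar ''b''))
            (RSub (Dist (nvar ''q'') (nvar ''b'')) (Dist (NArr ''A'' (nvar ''p'')) (nvar ''b'')))))
        (incr ''b''))"

text \<open>The order matters: the sums and \<open>M\<close> are updated while \<open>A[p]\<close>
  still names the outgoing element.\<close>

definition perform_swap :: com where
  "perform_swap =
     Seq (nset ''b'' (N 0))
    (Seq update_sums
    (Seq (NAssign ''M'' (NArr ''A'' (nvar ''p'')) (N 0))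
    (Seq (NAssign ''M'' (nvar ''q'') (N 1))
       (NAssign ''A'' (nvar ''p'') (nvar ''q'')))))"

text \<open>\<open>p = size\<close> is the sentinel for "no improving swap found"; with
  \<open>g\<close> starting at 0, only strict improvements replace it.\<close>

definition improve :: com where
  "improve =
     Seq (nset ''p'' (nvar ''size''))
    (Seq (rset ''g'' RZero)
    (Seq (nset ''b'' (N 0))
    (Seq search (Cond (below ''p'' ''size'') perform_swap Skip))))"

definition phase :: com where
  "phase = While (below ''e'' ''size'') (Seq improve (incr ''e''))"

text \<open>Nested counters perform \<open>size * L\<close> rounds without a multiplication.\<close>

definition phases :: com where
  "phases = While (below ''c'' ''L'') (Seq (nset ''e'' (N 0)) (Seq phase (incr ''c'')))"

definition local_search :: com where
  "local_search =
     Seq greedy (Seq (nset ''b'' (N 0)) (Seq sum_rows (Seq (nset ''w'' (N 1)) (Seq log_loop phases))))"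

text \<open>By injectivity, the overwritten slot was the only one naming the old element.\<close>

lemma image_fun_upd:
  assumes "inj_on A I" "i \<in> I"
  shows "(A(i := b)) ` I = insert b (A ` I - {A i})"
proof -
  have "A ` (I - {i}) = A ` I - {A i}"
    using inj_on_image_set_diff[OF assms(1), of I "{i}"] assms(2) by simp
  with assms(2) show ?thesis by (simp add: fun_upd_image cong del: image_cong_simp)
qed

text \<open>Everything is proved for the ground set of names that programs can see; abstract
  elements enter only through a later transport.\<close>

locale oracle_instance =
  fixes orc :: oracles and n k :: nat
  assumes is_matroid: "matroid {..<n} (Collect (indep_oracle orc))"
    and dist: "distance_on {..<n} (dist_oracle orc)"
    and neg: "negative_type {..<n} (dist_oracle orc)"
    and rank: "matroid_rank (Collect (indep_oracle orc)) = k"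
begin

sublocale matroid "{..<n}" "Collect (indep_oracle orc)" by (fact is_matroid)

abbreviation D :: "nat \<Rightarrow> nat \<Rightarrow> real" where "D \<equiv> dist_oracle orc"
abbreviation indep :: "nat set \<Rightarrow> bool" where "indep \<equiv> indep_oracle orc"

section \<open>Greedy basis, distance sums and the logarithm of the rank\<close>

definition greedy_inv :: "nat \<Rightarrow> state \<Rightarrow> bool" where
  "greedy_inv j s \<longleftrightarrow>
     (let A = nats s ''A''; m = nats s ''size'' 0; B = A ` {..<m} in
        nats s ''n'' 0 = n \<and> nats s ''b'' 0 = j \<and> nats s ''L'' 0 = 0 \<and> nats s ''c'' 0 = 0 \<and>
        reals s ''S'' = (\<lambda>x. 0) \<and> inj_on A {..<m} \<and> indep B \<and> B \<subseteq> {..<j} \<and>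
        (\<forall>x<j. x \<notin> B \<longrightarrow> \<not> indep (insert x B)) \<and> nats s ''M'' = (\<lambda>x. of_bool (x \<in> B)))"

definition solution :: "state \<Rightarrow> nat set" where
  "solution s = nats s ''A'' ` {..<k}"

definition config :: "state \<Rightarrow> bool" where
  "config s \<longleftrightarrow> nats s ''n'' 0 = n \<and> nats s ''size'' 0 = k \<and> inj_on (nats s ''A'') {..<k} \<and>
     indep (solution s) \<and> nats s ''M'' = (\<lambda>x. of_bool (x \<in> solution s))"

lemma runs_greedy:
  "runs orc greedy (input_state n)
     (\<lambda>t s. t \<le> 100 * (n + 1) \<and> config s \<and> nats s ''L'' 0 = 0 \<and> nats s ''c'' 0 = 0 \<and>
        reals s ''S'' = (\<lambda>x. 0))"
proof -
  \<comment> \<open>\<open>50\<close> generously bounds one loop body. The numerals in this and the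
    later time bounds are round overestimates.\<close>
  have "runs orc greedy (input_state n)
     (\<lambda>t s. t \<le> n * (50 + bcost (below ''b'' ''n'') + 1) + bcost (below ''b'' ''n'') + 1 \<and> greedy_inv n s)"
    unfolding greedy_def
  proof (rule runs_While[where I = greedy_inv], goal_cases)
    \<comment> \<open>The zero initial memory provides \<open>L\<close>, \<open>c\<close> and
      \<open>S\<close>, which the program never initialises; the invariant carries them to the later
      loops.\<close>
    case 1
    show ?case using empty_indep by (simp add: greedy_inv_def input_state_def)
  next
    case (2 j s)
    define A where "A = nats s ''A''"
    define m where "m = nats s ''size'' 0"
    define B where "B = A ` {..<m}"
    have s: "nats s ''A'' = A" "nats s ''size'' 0 = m" "A ` {..<m} = B"
      "nats s ''n'' 0 = n" "nats s ''b'' 0 = j" "nats s ''L'' 0 = 0" "nats s ''c'' 0 = 0"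
      "reals s ''S'' = (\<lambda>x. 0)" "nats s ''M'' = (\<lambda>x. of_bool (x \<in> B))"
      and inv: "inj_on A {..<m}" "indep B" "B \<subseteq> {..<j}" "\<And>x. x < j \<Longrightarrow> x \<notin> B \<Longrightarrow> \<not> indep (insert x B)"
      using 2(2) unfolding greedy_inv_def A_def m_def B_def Let_def by auto
    \<comment> \<open>The candidate is written to slot \<open>m\<close> before the query. If
      rejected, it stays beyond the valid prefix and does no harm.\<close>
    have img: "(A(m := j)) ` {..<m} = B" "(A(m := j)) ` {..<Suc m} = insert j B"
      by (auto simp: B_def lessThan_Suc)
    have inj: "inj_on (A(m := j)) {..<m}" "inj_on (A(m := j)) {..<Suc m}"
      using inv by (auto simp: inj_on_def B_def lessThan_Suc)
    \<comment> \<open>A rejected element stays rejected as the set grows, by heredity; so one pass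
      yields a maximal independent set, hence a basis.\<close>
    have dep: "\<not> indep (insert x (insert j B))" if "x < j" "x \<notin> B" for x
      using hereditary[of "insert x (insert j B)" "insert x B"] inv(4)[OF that] by auto
    show ?case
      using 2(1) inv dep
      by (auto simp: s img inj greedy_inv_def Let_def less_Suc_eq fun_eq_iff cong del: image_cong_simp)
  next
    case (3 s)
    then show ?case by (simp add: greedy_inv_def Let_def)
  qed
  then show ?thesis
  proof (rule runs_weaken)
    fix t s assume *: "t \<le> n * (50 + bcost (below ''b'' ''n'') + 1) + bcost (below ''b'' ''n'') + 1 \<and> greedy_inv n s"
    let ?m = "nats s ''size'' 0"
    from * have inv: "greedy_inv n s" by blast
    then have "card (nats s ''A'' ` {..<?m}) = k"
      using card_maximal_indep[of "nats s ''A'' ` {..<?m}"] rank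
      by (auto simp: greedy_inv_def Let_def)
    moreover have "card (nats s ''A'' ` {..<?m}) = ?m"
      using inv by (simp add: greedy_inv_def Let_def card_image)
    ultimately have "?m = k" by simp
    with * show "t \<le> 100 * (n + 1) \<and> config s \<and> nats s ''L'' 0 = 0 \<and> nats s ''c'' 0 = 0 \<and>
        reals s ''S'' = (\<lambda>x. 0)"
      by (auto simp: greedy_inv_def config_def solution_def Let_def)
  qed
qed

definition sums_ok :: "state \<Rightarrow> bool" where
  "sums_ok s \<longleftrightarrow> (\<forall>x<n. reals s ''S'' x = (\<Sum>y\<in>solution s. D y x))"

definition frame :: "vname set \<Rightarrow> state \<Rightarrow> state \<Rightarrow> bool" where
  "frame V s s' \<longleftrightarrow> (\<forall>x\<in>V. nats s' x = nats s x)"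

lemma runs_sum_row:
  assumes "nats s ''size'' 0 = k" "nats s ''i'' 0 = 0" "reals s ''S'' (nats s ''b'' 0) = 0"
  shows "runs orc sum_row s
    (\<lambda>t s'. t \<le> 100 * (k + 1) \<and> frame {''n'', ''size'', ''A'', ''M'', ''L'', ''c'', ''b''} s s' \<and>
      reals s' ''S'' = (reals s ''S'')(nats s ''b'' 0 := \<Sum>i<k. D (nats s ''A'' i) (nats s ''b'' 0)))"
proof -
  have "runs orc sum_row s
    (\<lambda>t s'. t \<le> k * (50 + bcost (below ''i'' ''size'') + 1) + bcost (below ''i'' ''size'') + 1 \<and>
      (frame {''n'', ''size'', ''A'', ''M'', ''L'', ''c'', ''b''} s s' \<and> nats s' ''i'' 0 = k \<and>
      reals s' ''S'' = (reals s ''S'')(nats s ''b'' 0 := \<Sum>i<k. D (nats s ''A'' i) (nats s ''b'' 0))))"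
    unfolding sum_row_def
    by (rule runs_While[where I = "\<lambda>j s'.
          frame {''n'', ''size'', ''A'', ''M'', ''L'', ''c'', ''b''} s s' \<and> nats s' ''i'' 0 = j \<and>
          reals s' ''S'' = (reals s ''S'')(nats s ''b'' 0 := \<Sum>i<j. D (nats s ''A'' i) (nats s ''b'' 0))"])
      (use assms in \<open>auto simp: frame_def fun_eq_iff\<close>)
  then show ?thesis by (rule runs_weaken) auto
qed

lemma runs_sum_rows:
  assumes "config s" "nats s ''b'' 0 = 0" "reals s ''S'' = (\<lambda>x. 0)"
  shows "runs orc sum_rows s
    (\<lambda>t s'. t \<le> 200 * (n + 1) * (k + 1) \<and> frame {''n'', ''size'', ''A'', ''M'', ''L'', ''c''} s s' \<and> sums_ok s')"
proof -
  let ?I = "\<lambda>j s'. frame {''n'', ''size'', ''A'', ''M'', ''L'', ''c''} s s' \<and> nats s' ''b'' 0 = j \<and>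
      reals s' ''S'' = (\<lambda>x. if x < j then \<Sum>i<k. D (nats s ''A'' i) x else 0)"
  have "runs orc sum_rows s
    (\<lambda>t s'. t \<le> n * (100 * (k + 1) + 50 + bcost (below ''b'' ''n'') + 1) + bcost (below ''b'' ''n'') + 1 \<and> ?I n s')"
    unfolding sum_rows_def
  proof (rule runs_While[where I = ?I], goal_cases)
    case 1
    then show ?case using assms by (simp add: frame_def)
  next
    case (2 j s1)
    then have s1: "nats s ''size'' 0 = k" "nats s1 ''size'' 0 = k" "nats s1 ''n'' 0 = n" "nats s1 ''b'' 0 = j"
      "reals s1 ''S'' j = 0" "nats s1 ''A'' = nats s ''A''"
      using assms by (auto simp: frame_def config_def)
    \<comment> \<open>The slack \<open>20\<close> pays for resetting \<open>i\<close> and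
      incrementing \<open>b\<close> around the inner loop; the same device recurs in the other
      nested loops.\<close>
    have "runs orc sum_row (nupd ''i'' 0 0 s1) (\<lambda>t s'. t + 20 \<le> 100 * (k + 1) + 50 \<and> ?I (Suc j) (nupd ''b'' 0 (Suc (nats s' ''b'' 0)) s'))"
      by (rule runs_weaken[OF runs_sum_row])
        (use 2 in \<open>auto simp: s1 frame_def fun_eq_iff less_Suc_eq\<close>)
    then show ?case using 2 s1 by (auto elim!: runs_weaken)
  next
    case (3 s1)
    then show ?case using assms by (auto simp: frame_def config_def)
  qed
  then show ?thesis
  proof (rule runs_weaken, goal_cases)
    case (1 t s')
    have "sums_ok s'"
      using 1 assms(1) by (auto simp: sums_ok_def solution_def frame_def config_def sum.reindex)
    then show ?case using 1 by (auto simp: algebra_simps frame_def)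
  qed
qed

lemma runs_log_loop:
  assumes "nats s ''size'' 0 = k" "nats s ''w'' 0 = 1" "nats s ''L'' 0 = 0"
  defines "m \<equiv> LEAST m. k \<le> 2 ^ m"
  shows "runs orc log_loop s
    (\<lambda>t s'. t \<le> 100 * (m + 1) \<and> frame {''n'', ''size'', ''A'', ''M'', ''c''} s s' \<and>
       nats s' ''L'' 0 = m \<and> reals s' = reals s)"
proof -
  have "k \<le> 2 ^ m" unfolding m_def by (rule LeastI[of _ k]) (simp add: less_imp_le)
  moreover have "2 ^ j < k" if "j < m" for j
    using not_less_Least[OF that[unfolded m_def]] by simp
  ultimately have "runs orc log_loop s
    (\<lambda>t s'. t \<le> m * (50 + bcost (below ''w'' ''size'') + 1) + bcost (below ''w'' ''size'') + 1 \<and>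
      (frame {''n'', ''size'', ''A'', ''M'', ''c''} s s' \<and> nats s' ''w'' 0 = 2 ^ m \<and> nats s' ''L'' 0 = m \<and>
       reals s' = reals s))"
    unfolding log_loop_def
    by (intro runs_While[where I = "\<lambda>j s'.
          frame {''n'', ''size'', ''A'', ''M'', ''c''} s s' \<and> nats s' ''w'' 0 = 2 ^ j \<and> nats s' ''L'' 0 = j \<and>
          reals s' = reals s"])
      (use assms(1-3) in \<open>auto simp: frame_def\<close>)
  then show ?thesis by (rule runs_weaken) auto
qed

section \<open>Finding and performing the best swap\<close>

definition found :: "state \<Rightarrow> (nat \<times> nat) set \<Rightarrow> real \<Rightarrow> nat \<Rightarrow> nat \<Rightarrow> bool" where
  "found s E g p q \<longleftrightarrow> 0 \<le> g \<and>
     (p = k \<and> g = 0 \<or>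
      p < k \<and> q \<in> {..<n} - solution s \<and> indep (insert q (solution s - {nats s ''A'' p})) \<and>
        g = swap_gain D (solution s) (nats s ''A'' p) q) \<and>
     (\<forall>(i, b)\<in>E. b \<notin> solution s \<longrightarrow> indep (insert b (solution s - {nats s ''A'' i})) \<longrightarrow>
        swap_gain D (solution s) (nats s ''A'' i) b \<le> g)"

lemma found_skip:
  assumes "found s E g p q"
    and "b \<notin> solution s \<Longrightarrow> indep (insert b (solution s - {nats s ''A'' i})) \<Longrightarrow>
      swap_gain D (solution s) (nats s ''A'' i) b \<le> g"
  shows "found s (insert (i, b) E) g p q"
  using assms unfolding found_def by blast

lemma found_better:
  assumes "found s E g p q" "i < k" "b < n" "b \<notin> solution s"
    and "indep (insert b (solution s - {nats s ''A'' i}))"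
    and "g < swap_gain D (solution s) (nats s ''A'' i) b"
  shows "found s (insert (i, b) E) (swap_gain D (solution s) (nats s ''A'' i) b) i b"
proof -
  let ?h = "swap_gain D (solution s) (nats s ''A'' i) b"
  have g: "0 \<le> g" and all: "\<And>i b. (i, b) \<in> E \<Longrightarrow> b \<notin> solution s \<Longrightarrow>
      indep (insert b (solution s - {nats s ''A'' i})) \<Longrightarrow> swap_gain D (solution s) (nats s ''A'' i) b \<le> g"
    using assms(1) unfolding found_def by blast+
  have "swap_gain D (solution s) (nats s ''A'' i') b' \<le> ?h"
    if "(i', b') \<in> insert (i, b) E" "b' \<notin> solution s" "indep (insert b' (solution s - {nats s ''A'' i'}))"
    for i' b'
    using that all[of i' b'] assms(6) by (cases "(i', b') = (i, b)") auto
  moreover have "0 \<le> ?h" using g assms(6) by linarith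
  ultimately show ?thesis using assms(2-5) unfolding found_def by blast
qed

text \<open>\<open>E\<close> collects the pairs (slot, candidate) already tried. Everything is
  measured against \<open>s\<close>, the state before the search, because \<open>try_swap\<close>
  overwrites a slot of \<open>A\<close> and restores it afterwards.\<close>

definition searching :: "state \<Rightarrow> (nat \<times> nat) set \<Rightarrow> state \<Rightarrow> bool" where
  "searching s E s' \<longleftrightarrow>
     frame {''n'', ''size'', ''A'', ''M'', ''L'', ''c'', ''e''} s s' \<and> reals s' ''S'' = reals s ''S'' \<and>
     found s E (reals s' ''g'' 0) (nats s' ''p'' 0) (nats s' ''q'' 0)"

text \<open>The test on \<open>M\<close> excludes candidates already in the solution, for which
  overwriting a slot would not be a swap.\<close>

lemma runs_try_swap:
  assumes s: "config s" "sums_ok s" and s': "searching s E s'"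
    and i: "nats s' ''i'' 0 = i" "i < k" and b: "nats s' ''b'' 0 = b" "b < n"
  shows "runs orc try_swap s'
    (\<lambda>t s''. t \<le> 80 \<and> searching s (insert (i, b) E) s'' \<and>
       nats s'' ''i'' 0 = Suc i \<and> nats s'' ''b'' 0 = b)"
proof -
  let ?A = "nats s ''A''"
  have fr: "nats s' ''n'' = nats s ''n''" "nats s' ''size'' = nats s ''size''" "nats s' ''A'' = ?A"
    "nats s' ''M'' = (\<lambda>x. of_bool (x \<in> solution s))" "nats s' ''L'' = nats s ''L''"
    "nats s' ''c'' = nats s ''c''" "nats s' ''e'' = nats s ''e''" "reals s' ''S'' = reals s ''S''"
    "nats s ''size'' 0 = k" "nats s ''M'' = (\<lambda>x. of_bool (x \<in> solution s))"
    using s s' by (auto simp: searching_def frame_def config_def)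
  have found: "found s E (reals s' ''g'' 0) (nats s' ''p'' 0) (nats s' ''q'' 0)"
    using s' by (simp add: searching_def)
  have inj: "inj_on ?A {..<k}" using s by (simp add: config_def)
  have img: "(?A(i := b)) ` {..<k} = insert b (solution s - {?A i})"
    unfolding solution_def using inj i by (intro image_fun_upd) auto
  \<comment> \<open>\<open>sums_ok\<close> vouches only for entries below \<open>n\<close>.\<close>
  have "?A i < n" using s i indep_subset unfolding config_def solution_def by blast
  then have gain: "reals s ''S'' b - D (?A i) b - reals s ''S'' (?A i) = swap_gain D (solution s) (?A i) b"
    using s(2) b(2) by (simp add: sums_ok_def swap_gain_def)
  note found_skip[OF found, of b i] found_better[OF found i(2) b(2)]
  then show ?thesis
    by (auto simp: try_swap_def gain_exp_def searching_def frame_def fr i(1) b(1) img gain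
      cong del: image_cong_simp)
qed

lemma runs_search_row:
  assumes s: "config s" "sums_ok s" and s': "searching s ({..<k} \<times> {..<b}) s'"
    and i: "nats s' ''i'' 0 = 0" and b: "nats s' ''b'' 0 = b" "b < n"
  shows "runs orc search_row s'
    (\<lambda>t s''. t \<le> 100 * (k + 1) \<and> searching s ({..<k} \<times> {..<Suc b}) s'' \<and> nats s'' ''b'' 0 = b)"
proof -
  let ?I = "\<lambda>j s''. searching s ({..<k} \<times> {..<b} \<union> {..<j} \<times> {b}) s'' \<and>
    nats s'' ''i'' 0 = j \<and> nats s'' ''b'' 0 = b"
  have "runs orc search_row s'
    (\<lambda>t s''. t \<le> k * (80 + bcost (below ''i'' ''size'') + 1) + bcost (below ''i'' ''size'') + 1 \<and> ?I k s'')"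
    unfolding search_row_def
  proof (rule runs_While[where I = ?I], goal_cases)
    case 1
    then show ?case using s' i b by simp
  next
    case (2 j s1)
    then have "nats s1 ''size'' 0 = k" using s by (simp add: searching_def frame_def config_def)
    moreover have "insert (j, b) ({..<k} \<times> {..<b} \<union> {..<j} \<times> {b}) = {..<k} \<times> {..<b} \<union> {..<Suc j} \<times> {b}"
      by auto
    moreover have "runs orc try_swap s1 (\<lambda>t s''. t \<le> 80 \<and>
        searching s (insert (j, b) ({..<k} \<times> {..<b} \<union> {..<j} \<times> {b})) s'' \<and>
        nats s'' ''i'' 0 = Suc j \<and> nats s'' ''b'' 0 = b)"
      using 2 b by (intro runs_try_swap[OF s]) simp_all
    ultimately show ?case using 2 by simp
  next
    case (3 s1)
    then show ?case using s by (simp add: searching_def frame_def config_def)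
  qed
  then show ?thesis
  proof (rule runs_weaken, goal_cases)
    case 1
    moreover have "{..<k} \<times> {..<b} \<union> {..<k} \<times> {b} = {..<k} \<times> {..<Suc b}" by auto
    ultimately show ?case by simp
  qed
qed

lemma runs_search:
  assumes s: "config s" "sums_ok s" and s': "searching s {} s'" and b: "nats s' ''b'' 0 = 0"
  shows "runs orc search s'
    (\<lambda>t s''. t \<le> 200 * (n + 1) * (k + 1) \<and> searching s ({..<k} \<times> {..<n}) s'')"
proof -
  let ?I = "\<lambda>j s''. searching s ({..<k} \<times> {..<j}) s'' \<and> nats s'' ''b'' 0 = j"
  have "runs orc search s'
    (\<lambda>t s''. t \<le> n * (100 * (k + 1) + 50 + bcost (below ''b'' ''n'') + 1) + bcost (below ''b'' ''n'') + 1 \<and> ?I n s'')"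
    unfolding search_def
  proof (rule runs_While[where I = ?I], goal_cases)
    case 1
    then show ?case using s' b by simp
  next
    case (2 j s1)
    have "nats s1 ''n'' 0 = n" using 2 s by (simp add: searching_def frame_def config_def)
    moreover have "runs orc search_row (nupd ''i'' 0 0 s1)
      (\<lambda>t s''. t \<le> 100 * (k + 1) \<and> searching s ({..<k} \<times> {..<Suc j}) s'' \<and> nats s'' ''b'' 0 = j)"
      using 2 s by (intro runs_search_row) (auto simp: searching_def frame_def)
    then have "runs orc search_row (nupd ''i'' 0 0 s1)
      (\<lambda>t s''. t + 20 \<le> 100 * (k + 1) + 50 \<and> ?I (Suc j) (nupd ''b'' 0 (Suc (nats s'' ''b'' 0)) s''))"
      by (rule runs_weaken) (auto simp: searching_def frame_def)
    ultimately show ?case using 2 by (auto elim!: runs_weaken)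
  next
    case (3 s1)
    then show ?case using s by (simp add: searching_def frame_def config_def)
  qed
  then show ?thesis by (rule runs_weaken) (auto simp: algebra_simps)
qed

lemma runs_update_sums:
  assumes "config s" "nats s ''b'' 0 = 0"
  shows "runs orc update_sums s
    (\<lambda>t s'. t \<le> 100 * (n + 1) \<and>
       frame {''n'', ''size'', ''A'', ''M'', ''L'', ''c'', ''e'', ''p'', ''q''} s s' \<and>
       (\<forall>x<n. reals s' ''S'' x =
          reals s ''S'' x + (D (nats s ''q'' 0) x - D (nats s ''A'' (nats s ''p'' 0)) x)))"
proof -
  let ?I = "\<lambda>j s'. frame {''n'', ''size'', ''A'', ''M'', ''L'', ''c'', ''e'', ''p'', ''q''} s s' \<and>
    nats s' ''b'' 0 = j \<and>
    reals s' ''S'' = (\<lambda>x. if x < j then reals s ''S'' x + (D (nats s ''q'' 0) x - D (nats s ''A'' (nats s ''p'' 0)) x)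
       else reals s ''S'' x)"
  have "runs orc update_sums s
    (\<lambda>t s'. t \<le> n * (50 + bcost (below ''b'' ''n'') + 1) + bcost (below ''b'' ''n'') + 1 \<and> ?I n s')"
    unfolding update_sums_def
    by (rule runs_While[where I = ?I]) (use assms in \<open>auto simp: frame_def config_def fun_eq_iff less_Suc_eq\<close>)
  then show ?thesis by (rule runs_weaken) auto
qed

lemma runs_perform_swap:
  assumes s: "config s" "sums_ok s"
    and p: "nats s ''p'' 0 = p" "p < k"
    and q: "nats s ''q'' 0 = q" "q \<in> {..<n} - solution s"
      "indep (insert q (solution s - {nats s ''A'' p}))"
  shows "runs orc perform_swap s
    (\<lambda>t s'. t \<le> 150 * (n + 1) \<and> frame {''L'', ''c'', ''e''} s s' \<and> config s' \<and> sums_ok s' \<and>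
       dispersion D (solution s') = dispersion D (solution s) + swap_gain D (solution s) (nats s ''A'' p) q)"
proof -
  let ?A = "nats s ''A''"
  let ?B = "insert q (solution s - {?A p})"
  have inj: "inj_on ?A {..<k}" using s by (simp add: config_def)
  have img: "(?A(p := q)) ` {..<k} = ?B"
    unfolding solution_def using inj p by (intro image_fun_upd) auto
  have Ap: "?A p \<in> solution s" using p by (simp add: solution_def)
  have sub: "solution s \<subseteq> {..<n}" using s indep_subset unfolding config_def by blast
  then have fin: "finite (solution s)" using finite_subset by blast
  have inj': "inj_on (?A(p := q)) {..<k}"
    using inj q(2) p by (auto simp: inj_on_def solution_def)
  have disp: "dispersion D ?B = dispersion D (solution s) + swap_gain D (solution s) (?A p) q"
    using q sub Ap by (intro dispersion_swap[OF finite_ground dist]) auto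
  have sum: "(\<Sum>y\<in>?B. D y x) = (\<Sum>y\<in>solution s. D y x) + (D q x - D (?A p) x)" for x
    using fin Ap q(2) by (simp add: sum_diff1)
  show ?thesis
    unfolding perform_swap_def runs_Seq runs_basic
  proof (rule runs_weaken[OF runs_update_sums], goal_cases)
    case 1
    then show ?case using s by (simp add: config_def solution_def)
  next
    case 2
    then show ?case by simp
  next
    case (3 t s')
    have fr: "nats s' ''n'' 0 = n" "nats s' ''size'' 0 = k" "nats s' ''A'' = ?A"
      "nats s' ''M'' = (\<lambda>x. of_bool (x \<in> solution s))" "nats s' ''p'' 0 = p" "nats s' ''q'' 0 = q"
      "nats s' ''L'' = nats s ''L''" "nats s' ''c'' = nats s ''c''" "nats s' ''e'' = nats s ''e''"
      and S: "\<And>x. x < n \<Longrightarrow> reals s' ''S'' x = (\<Sum>y\<in>?B. D y x)" and t: "t \<le> 100 * (n + 1)"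
      using 3 s p q unfolding sum by (auto simp: frame_def config_def sums_ok_def)
    let ?s = "nupd ''A'' p q (nupd ''M'' q (Suc 0) (nupd ''M'' (?A p) 0 s'))"
    have A: "nats ?s ''A'' = ?A(p := q)" by (simp add: fr)
    then have sol: "solution ?s = ?B" unfolding solution_def[of ?s] using img by (simp only:)
    have M: "nats ?s ''M'' = (\<lambda>x. of_bool (x \<in> ?B))"
      using q by (auto simp: fr fun_eq_iff)
    have "config ?s"
      unfolding config_def sol A M using inj' q by (simp add: fr)
    moreover have "sums_ok ?s" unfolding sums_ok_def sol using S by simp
    moreover have "frame {''L'', ''c'', ''e''} s ?s" by (simp add: frame_def fr)
    ultimately show ?case using t disp by (simp add: sol fr)
  qed
qed

section \<open>Geometric convergence of the rounds\<close>

definition opt_gap :: "nat set \<Rightarrow> real \<Rightarrow> real" where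
  "opt_gap B x = (1 - 2 / k) * dispersion D B - (1 + 2 / k) * x"

text \<open>A round performs the best swap or, at a local optimum, nothing. Either way the
  dispersion grows by exactly the recorded \<open>g\<close>, to which \<open>best_swap_gain\<close>
  applies.\<close>

lemma runs_improve:
  assumes s: "config s" "sums_ok s" and k: "0 < k" and B: "indep B" "card B = k"
  shows "runs orc improve s
    (\<lambda>t s'. t \<le> 400 * (n + 1) * (k + 1) \<and> frame {''L'', ''c'', ''e''} s s' \<and> config s' \<and> sums_ok s' \<and>
       dispersion D (solution s) \<le> dispersion D (solution s') \<and>
       opt_gap B (dispersion D (solution s)) \<le>
         k * (dispersion D (solution s') - dispersion D (solution s)))"
proof -
  let ?s = "nupd ''b'' 0 0 (rupd ''g'' 0 0 (nupd ''p'' 0 (nats s ''size'' 0) s))"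
  have size: "nats s ''size'' 0 = k" using s by (simp add: config_def)
  have B': "B \<in> Collect indep" "solution s \<in> Collect indep" "card (solution s) = k"
    using s B by (auto simp: config_def solution_def card_image)
  have opt: "opt_gap B (dispersion D (solution s)) \<le> k * g" if "found s ({..<k} \<times> {..<n}) g p q" for g :: real and p q
    unfolding opt_gap_def
  proof (rule best_swap_gain[OF dist neg B'(2,1,3) B(2) k])
    show "0 \<le> g" using that by (simp add: found_def)
  next
    fix a b assume ab: "a \<in> solution s" "b \<in> {..<n} - solution s"
      "insert b (solution s - {a}) \<in> Collect indep"
    then obtain i where "i < k" "a = nats s ''A'' i" by (auto simp: solution_def)
    with ab that show "swap_gain D (solution s) a b \<le> g" by (auto simp: found_def)
  qed
  have "searching s {} ?s" using size by (simp add: searching_def frame_def found_def)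
  then have "runs orc search ?s
      (\<lambda>t s''. t \<le> 200 * (n + 1) * (k + 1) \<and> searching s ({..<k} \<times> {..<n}) s'')"
    by (intro runs_search s) simp_all
  then have "runs orc search ?s (\<lambda>t s1. runs orc (Cond (below ''p'' ''size'') perform_swap Skip) s1
    (\<lambda>t' s'. 10 + t + t' \<le> 400 * (n + 1) * (k + 1) \<and> frame {''L'', ''c'', ''e''} s s' \<and> config s' \<and> sums_ok s' \<and>
       dispersion D (solution s) \<le> dispersion D (solution s') \<and>
       opt_gap B (dispersion D (solution s)) \<le>
         k * (dispersion D (solution s') - dispersion D (solution s))))"
  proof (rule runs_weaken, goal_cases)
    case (1 t s1)
    define g where "g = reals s1 ''g'' 0"
    define p where "p = nats s1 ''p'' 0"
    define q where "q = nats s1 ''q'' 0"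
    have search: "searching s ({..<k} \<times> {..<n}) s1" using 1 by blast
    then have fr: "config s1" "solution s1 = solution s" "sums_ok s1" "nats s1 ''A'' = nats s ''A''"
        "nats s1 ''size'' 0 = k" "frame {''L'', ''c'', ''e''} s s1"
      and found: "found s ({..<k} \<times> {..<n}) g p q"
      using s size by (auto simp: searching_def frame_def config_def solution_def sums_ok_def g_def p_def q_def)
    have t: "10 + t + t' \<le> 400 * (n + 1) * (k + 1)" if "t' \<le> 150 * (n + 1) + 7" for t'
    proof -
      have "200 * (n + 1) * (k + 1) + (150 * (n + 1) + 17) \<le> 400 * (n + 1) * (k + 1)"
        by (simp add: algebra_simps)
      with that 1 show ?thesis by linarith
    qed
    from found consider (none) "p = k" "g = 0" | (swap) "p < k" "q \<in> {..<n} - solution s"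
        "indep (insert q (solution s - {nats s ''A'' p}))"
        "g = swap_gain D (solution s) (nats s ''A'' p) q"
      unfolding found_def by blast
    then show ?case
    proof cases
      case none
      then have "\<not> bval orc (below ''p'' ''size'') s1" by (simp add: fr p_def)
      then show ?thesis using opt[OF found] none fr t[of 7] by simp
    next
      case swap
      then have b: "bval orc (below ''p'' ''size'') s1" by (simp add: fr p_def)
      have "runs orc perform_swap s1
        (\<lambda>t s'. t \<le> 150 * (n + 1) \<and> frame {''L'', ''c'', ''e''} s1 s' \<and> config s' \<and> sums_ok s' \<and>
          dispersion D (solution s') = dispersion D (solution s1) + swap_gain D (solution s1) (nats s1 ''A'' p) q)"
        using swap by (intro runs_perform_swap) (auto simp: fr p_def q_def)
      then show ?thesis
        unfolding runs_Cond if_P[OF b]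
      proof (rule runs_weaken, goal_cases)
        case (1 t' s')
        moreover have "0 \<le> g" using found by (simp add: found_def)
        ultimately show ?case
          using opt[OF found] swap fr t[of "1 + bcost (below ''p'' ''size'') + t'"]
          by (simp add: frame_def)
      qed
    qed
  qed
  then show ?thesis unfolding improve_def by (simp del: runs_Cond)
qed

text \<open>With \<open>F = (k - 2)/(k + 2) * dispersion D B\<close>, this solves the recursion in
  which the distance to \<open>F\<close> shrinks by the factor \<open>1 - 1/k\<close> per round,
  starting from the value 0.\<close>

definition lower :: "nat set \<Rightarrow> nat \<Rightarrow> real" where
  "lower B t = (real k - 2) / (k + 2) * dispersion D B * (1 - (1 - 1 / k) ^ t)"

lemma lower_step:
  fixes x y :: real
  assumes "2 \<le> k" and le: "x \<le> y" and gap: "opt_gap B x \<le> k * (y - x)" and x: "lower B t \<le> x"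
    and nonneg: "0 \<le> dispersion D B"
  shows "lower B (Suc t) \<le> y"
proof -
  define F where "F = (real k - 2) / (k + 2) * dispersion D B"
  have F: "0 \<le> F" using assms by (simp add: F_def)
  have lower: "lower B t = F - F * (1 - 1 / k) ^ t" for t
    unfolding lower_def F_def by (simp only: right_diff_distrib mult_1_right)
  show ?thesis
  \<comment> \<open>Once \<open>F\<close> is reached, monotonicity suffices. Below it,
    \<open>F - x\<close> is positive, so the factor \<open>1 + 2/k\<close> in the gap can be
    weakened to 1, which yields the contraction \<open>1 - 1/k\<close>.\<close>
  proof (cases "F \<le> x")
    case True
    have "0 \<le> F * (1 - 1 / k) ^ Suc t" using F assms(1) by (intro mult_nonneg_nonneg) auto
    with True le show ?thesis unfolding lower by linarith
  next
    case False
    have "1 - 2 / real k = (1 + 2 / k) * ((real k - 2) / (k + 2))"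
      using assms(1) by (simp add: divide_simps)
    then have "opt_gap B x = (1 + 2 / k) * (F - x)"
      unfolding opt_gap_def F_def by (simp only: right_diff_distrib mult.assoc)
    moreover have "1 * (F - x) \<le> (1 + 2 / k) * (F - x)"
      using False by (intro mult_right_mono) auto
    ultimately have "1 * (F - x) \<le> k * (y - x)" using gap by (simp only:)
    then have "F - y \<le> (1 - 1 / k) * (F - x)" using assms(1) by (simp add: field_simps)
    also have "\<dots> \<le> (1 - 1 / k) * (F * (1 - 1 / k) ^ t)"
      using x assms(1) unfolding lower by (intro mult_left_mono) auto
    finally show ?thesis unfolding lower by (simp add: mult_ac)
  qed
qed

definition progress :: "nat set \<Rightarrow> nat \<Rightarrow> state \<Rightarrow> bool" where
  "progress B t s \<longleftrightarrow> config s \<and> sums_ok s \<and> lower B t \<le> dispersion D (solution s)"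

lemma runs_phase:
  assumes s: "progress B t s" "nats s ''e'' 0 = 0" and k: "2 \<le> k" and B: "indep B" "card B = k"
  shows "runs orc phase s
    (\<lambda>u s'. u \<le> 500 * (n + 1) * (k + 1)\<^sup>2 \<and> frame {''L'', ''c''} s s' \<and> progress B (t + k) s')"
proof -
  let ?I = "\<lambda>j s'. frame {''L'', ''c''} s s' \<and> progress B (t + j) s' \<and> nats s' ''e'' 0 = j"
  have nonneg: "0 \<le> dispersion D B"
    using dispersion_nonneg_indep[OF dist] B(1) by simp
  have "runs orc phase s (\<lambda>t s'. t \<le> k * (400 * (n + 1) * (k + 1) + 30 + bcost (below ''e'' ''size'') + 1) +
      bcost (below ''e'' ''size'') + 1 \<and> ?I k s')"
    unfolding phase_def
  proof (rule runs_While[where I = ?I], goal_cases)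
    case 1
    then show ?case using s by (simp add: frame_def)
  next
    case (2 j s1)
    then have s1: "config s1" "sums_ok s1" "nats s1 ''size'' 0 = k"
      by (auto simp: progress_def config_def)
    have "runs orc improve s1
     (\<lambda>u s'. u + 20 \<le> 400 * (n + 1) * (k + 1) + 30 \<and> ?I (Suc j) (nupd ''e'' 0 (Suc (nats s' ''e'' 0)) s'))"
    proof (rule runs_weaken[OF runs_improve[OF s1(1,2) _ B]], goal_cases)
      case 1
      then show ?case using k by simp
    next
      case (2 u s')
      then have "lower B (Suc (t + j)) \<le> dispersion D (solution s')"
        using lower_step[OF k, where x = "dispersion D (solution s1)"] nonneg \<open>frame _ s s1 \<and> _\<close>
        by (auto simp: progress_def)
      with 2 \<open>frame _ s s1 \<and> _\<close> show ?case
        by (simp add: frame_def progress_def config_def sums_ok_def solution_def)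
    qed
    then show ?case using 2 s1 by (auto elim!: runs_weaken)
  next
    case (3 s1)
    then show ?case by (simp add: progress_def config_def)
  qed
  then show ?thesis
    by (rule runs_weaken) (auto simp: algebra_simps power2_eq_square)
qed

lemma runs_phases:
  assumes s: "progress B 0 s" "nats s ''c'' 0 = 0" "nats s ''L'' 0 = m"
    and k: "0 < m \<Longrightarrow> 2 \<le> k" and B: "indep B" "card B = k"
  shows "runs orc phases s
    (\<lambda>u s'. u \<le> 600 * (n + 1) * (k + 1)\<^sup>2 * (m + 1) \<and> progress B (k * m) s')"
proof -
  let ?I = "\<lambda>j s'. nats s' ''L'' 0 = m \<and> progress B (k * j) s' \<and> nats s' ''c'' 0 = j"
  have "runs orc phases s (\<lambda>t s'. t \<le> m * (500 * (n + 1) * (k + 1)\<^sup>2 + 50 + bcost (below ''c'' ''L'') + 1) +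
      bcost (below ''c'' ''L'') + 1 \<and> ?I m s')"
    unfolding phases_def
  proof (rule runs_While[where I = ?I], goal_cases)
    case 1
    then show ?case using s by simp
  next
    case (2 j s1)
    have "runs orc phase (nupd ''e'' 0 0 s1)
     (\<lambda>u s'. u + 20 \<le> 500 * (n + 1) * (k + 1)\<^sup>2 + 50 \<and> ?I (Suc j) (nupd ''c'' 0 (Suc (nats s' ''c'' 0)) s'))"
      by (rule runs_weaken[OF runs_phase[OF _ _ _ B, of "k * j"]])
        (use 2 k in \<open>auto simp: frame_def progress_def config_def sums_ok_def solution_def add.commute\<close>)
    then show ?case using 2 by (auto elim!: runs_weaken)
  next
    case (3 s1)
    then show ?case by simp
  qed
  then show ?thesis
    by (rule runs_weaken) (auto simp: algebra_simps power2_eq_square)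
qed

lemma runs_local_search:
  assumes B: "indep B" "card B = k"
  defines "m \<equiv> LEAST m. k \<le> 2 ^ m"
  shows "runs orc local_search (input_state n)
    (\<lambda>u s'. u \<le> 2000 * (n + 1) * (k + 1)\<^sup>2 * (m + 1) \<and> progress B (k * m) s')"
proof -
  have nonneg: "0 \<le> dispersion D A" if "indep A" for A
    using dispersion_nonneg_indep[OF dist] that by simp
  \<comment> \<open>For \<open>k <= 1\<close> the exponent \<open>m\<close> is 0 and no phase
    runs.\<close>
  have k: "2 \<le> k" if "0 < m"
    using not_less_Least[of 0 "\<lambda>m. k \<le> 2 ^ m"] that unfolding m_def by simp
  \<comment> \<open>\<open>P\<close> dominates the cost of each stage, because the other cost terms
    divide it.\<close>
  define P where "P = (n + 1) * (k + 1)\<^sup>2 * (m + 1)"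
  have "0 < P" by (simp add: P_def)
  moreover have "n + 1 dvd P" "m + 1 dvd P"
    unfolding P_def by (intro dvd_mult2 dvd_triv_left dvd_triv_right)+
  moreover have "(n + 1) * (k + 1) dvd P"
    unfolding P_def by (intro dvd_mult2 mult_dvd_mono dvd_refl dvd_power) simp
  ultimately have bounds: "n + 1 \<le> P" "(n + 1) * (k + 1) \<le> P" "m + 1 \<le> P"
    by (simp_all only: dvd_imp_le)
  have goal: "2000 * (n + 1) * (k + 1)\<^sup>2 * (m + 1) = 2000 * P"
    "600 * (n + 1) * (k + 1)\<^sup>2 * (m + 1) = 600 * P"
    "200 * (n + 1) * (k + 1) = 200 * ((n + 1) * (k + 1))"
    by (simp_all only: P_def mult.assoc)
  show ?thesis
    unfolding local_search_def goal runs_Seq runs_basic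
  proof (rule runs_weaken[OF runs_greedy], goal_cases)
    case (1 t1 s1)
    let ?s1 = "nupd ''b'' (nval (N 0) s1) (nval (N 0) s1) s1"
    have s1: "config ?s1" "nats ?s1 ''b'' 0 = 0" "reals ?s1 ''S'' = (\<lambda>x. 0)"
      using 1 by (simp_all add: config_def solution_def)
    show ?case
    proof (rule runs_weaken[OF runs_sum_rows[OF s1]], goal_cases)
      case (1 t2 s2)
      let ?s2 = "nupd ''w'' (nval (N 0) s2) (nval (N 1) s2) s2"
      have fr2: "config s2" "sums_ok s2" "nats s2 ''L'' 0 = 0" "nats s2 ''c'' 0 = 0"
        using 1 s1 \<open>_ \<and> config s1 \<and> _\<close> by (auto simp: frame_def config_def solution_def)
      then have s2: "nats ?s2 ''size'' 0 = k" "nats ?s2 ''w'' 0 = 1" "nats ?s2 ''L'' 0 = 0"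
        by (simp_all add: config_def)
      show ?case
      proof (rule runs_weaken[OF runs_log_loop[OF s2]], goal_cases)
        case (1 t3 s3)
        have "config s3" "sums_ok s3" "nats s3 ''c'' 0 = 0" "nats s3 ''L'' 0 = m"
          using 1 fr2 by (auto simp: frame_def config_def solution_def sums_ok_def m_def)
        moreover have "progress B 0 s3"
          using calculation nonneg by (simp add: progress_def lower_def config_def)
        ultimately have "runs orc phases s3
            (\<lambda>u s'. u \<le> 600 * P \<and> progress B (k * m) s')"
          unfolding goal[symmetric] by (intro runs_phases k B)
        then show ?case
        proof (rule runs_weaken, goal_cases)
          case (1 u s')
          have t: "t1 \<le> 100 * (n + 1)" "t2 \<le> 200 * ((n + 1) * (k + 1))" "t3 \<le> 100 * (m + 1)"
            using \<open>t1 \<le> _ \<and> _\<close> \<open>t2 \<le> _ \<and> _\<close> \<open>t3 \<le> _ \<and> _\<close> unfolding m_def goal by blast+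
          have "t1 \<le> 100 * P" using order_trans[OF t(1) mult_le_mono2[OF bounds(1)]] .
          moreover have "t2 \<le> 200 * P" using order_trans[OF t(2) mult_le_mono2[OF bounds(2)]] .
          moreover have "t3 \<le> 100 * P" using order_trans[OF t(3) mult_le_mono2[OF bounds(3)]] .
          ultimately show ?case using 1 bounds by simp
        qed
      qed
    qed
  qed
qed

end

section \<open>Transport to an abstract ground set, and the final estimates\<close>

lemma oracle_instance_instance_oracles:
  assumes dist: "distance_on X d" and neg: "negative_type X d"
    and matroid: "matroid X \<I>" and rank: "matroid_rank \<I> = k"
    and e: "bij_betw e {..<n} X"
  shows "oracle_instance (instance_oracles n e d \<I>) n k"
proof -
  interpret M: matroid X \<I> by (rule matroid)
  let ?orc = "instance_oracles n e d \<I>"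
  let ?J = "{S. S \<subseteq> {..<n} \<and> e ` S \<in> \<I>}"
  have J: "Collect (indep_oracle ?orc) = ?J" by (simp add: instance_oracles_def)
  have D: "dist_oracle ?orc i j = d (e i) (e j)" if "i < n" "j < n" for i j
    using that by (simp add: instance_oracles_def)
  have eX: "e i \<in> X" if "i < n" for i using e that by (auto simp: bij_betw_def)
  have card: "card (e ` S) = card S" if "S \<subseteq> {..<n}" for S
    using e that by (meson bij_betw_imp_inj_on card_image inj_on_subset)
  have "matroid {..<n} ?J"
  proof
    fix S T assume S: "S \<in> ?J" and T: "T \<in> ?J" and less: "card S < card T"
    then obtain x where "x \<in> e ` T - e ` S" "insert x (e ` S) \<in> \<I>"
      using M.exchange[of "e ` S" "e ` T"] card by auto
    then obtain a where "a \<in> T - S" "e ` insert a S \<in> \<I>" by auto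
    with S T show "\<exists>a\<in>T - S. insert a S \<in> ?J" by blast
  next
    fix S T assume "T \<in> ?J" "S \<subseteq> T"
    then show "S \<in> ?J" using M.hereditary[of "e ` T" "e ` S"] by blast
  qed (use M.empty_indep in auto)
  moreover have "distance_on {..<n} (dist_oracle ?orc)"
    using dist eX D unfolding distance_on_def by simp
  moreover have "negative_type {..<n} (dist_oracle ?orc)"
    unfolding negative_type_def
  proof (intro allI impI)
    fix x :: "nat \<Rightarrow> real" assume x: "(\<Sum>i<n. x i) = 0"
    \<comment> \<open>A test vector on names is pushed forward along \<open>e\<close>, where
      negative type of \<open>d\<close> applies.\<close>
    define y where "y = x \<circ> inv_into {..<n} e"
    have y: "y (e i) = x i" if "i < n" for i
      using e that by (simp add: y_def bij_betw_inv_into_left)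
    have "(\<Sum>a\<in>X. y a) = 0"
      using x y by (simp flip: sum.reindex_bij_betw[OF e])
    then have "(\<Sum>a\<in>X. \<Sum>b\<in>X. y a * d a b * y b) \<le> 0"
      using neg unfolding negative_type_def by blast
    then show "(\<Sum>i<n. \<Sum>j<n. x i * dist_oracle ?orc i j * x j) \<le> 0"
      using y D by (simp flip: sum.reindex_bij_betw[OF e])
  qed
  moreover have "card ` ?J = card ` \<I>"
  proof (intro equalityI subsetI)
    fix c assume "c \<in> card ` ?J"
    then obtain S where "S \<subseteq> {..<n}" "e ` S \<in> \<I>" "c = card S" by auto
    then show "c \<in> card ` \<I>" using card by (metis imageI)
  next
    fix c assume "c \<in> card ` \<I>"
    then obtain S where S: "S \<in> \<I>" "c = card S" by auto
    then obtain T where "T \<subseteq> {..<n}" "e ` T = S"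
      using M.indep_subset[OF S(1)] e by (metis bij_betw_def subset_imageE)
    with S show "c \<in> card ` ?J" using card by auto
  qed
  then have "matroid_rank ?J = k" using rank by (simp add: matroid_rank_def)
  ultimately show ?thesis unfolding oracle_instance_def J by blast
qed

text \<open>\<open>k\<close> rounds shrink the gap by \<open>(1 - 1/k)^k <= exp (-1) <= 1/2\<close>,
  so \<open>m\<close> phases give at most \<open>1/2^m <= 1/k\<close>.\<close>

lemma power_inverse_le:
  assumes "k \<le> 2 ^ m" "2 \<le> k"
  shows "(1 - 1 / real k) ^ (k * m) \<le> 1 / k"
proof -
  have "(1 - 1 / real k) ^ k \<le> exp (- 1 / k) ^ k"
    using assms(2) exp_ge_add_one_self[of "- 1 / real k"] by (intro power_mono) auto
  also have "\<dots> = exp (- 1)" using assms(2) by (simp flip: exp_of_nat_mult)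
  also have "\<dots> \<le> 1 / 2"
    using exp_ge_add_one_self[of 1] by (simp add: exp_minus field_simps)
  finally have "((1 - 1 / real k) ^ k) ^ m \<le> (1 / 2) ^ m"
    using assms(2) by (intro power_mono) auto
  also have "\<dots> = 1 / real (2 ^ m)" by (simp add: power_one_over)
  also have "\<dots> \<le> 1 / real k"
    using assms by (intro divide_left_mono) (simp_all only: of_nat_le_iff, auto)
  finally show ?thesis by (simp only: power_mult)
qed

text \<open>Here the 5 is fixed: \<open>(k - 2) * (k - 1)\<close> exceeds
  \<open>(k - 5) * (k + 2)\<close> by 12, the terms linear in \<open>k\<close> agreeing.\<close>

lemma approximation_arith:
  assumes k: "2 \<le> k" "k \<le> 2 ^ m" and "0 \<le> v"
  shows "(1 - 5 / real k) * v \<le> (real k - 2) / (real k + 2) * v * (1 - (1 - 1 / k) ^ (k * m))"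
proof -
  have "1 - 5 / real k = (real k - 5) * (real k + 2) / (real k * (real k + 2))"
    using k(1) by (simp add: diff_divide_distrib)
  also have "\<dots> \<le> (real k - 2) * (real k - 1) / (real k * (real k + 2))"
    by (intro divide_right_mono) (simp_all add: algebra_simps)
  also have "\<dots> = (real k - 2) / (real k + 2) * ((real k - 1) / k)"
    by (simp only: times_divide_times_eq mult.commute)
  also have "\<dots> = (real k - 2) / (real k + 2) * (1 - 1 / k)"
    using k(1) by (simp add: diff_divide_distrib)
  also have "\<dots> \<le> (real k - 2) / (real k + 2) * (1 - (1 - 1 / k) ^ (k * m))"
    using power_inverse_le[OF k(2,1)] k(1) by (intro mult_left_mono) auto
  finally have "(1 - 5 / real k) * v \<le> (real k - 2) / (real k + 2) * (1 - (1 - 1 / k) ^ (k * m)) * v"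
    using \<open>0 \<le> v\<close> by (rule mult_right_mono)
  then show ?thesis by (simp only: mult_ac)
qed

text \<open>\<open>48000 = 2000 * 2 * 4 * 3\<close>, from \<open>n + 1 <= 2 * n\<close>,
  \<open>(k + 1)^2 <= 4 * k^2\<close> and \<open>m + 1 <= 3 * log 2 k\<close>. The last holds since
  \<open>m - 1 < log 2 k\<close> and \<open>1 <= log 2 k\<close>.\<close>

lemma time_arith:
  assumes "2 \<le> k" "k \<le> n"
  defines "m \<equiv> LEAST m. k \<le> 2 ^ m"
  shows "real (2000 * (n + 1) * (k + 1)\<^sup>2 * (m + 1)) \<le> 48000 * (real n * (real k)\<^sup>2 * log 2 k)"
proof -
  have log: "1 \<le> log 2 k" using assms(1) by (simp add: le_log_iff)
  have "m \<noteq> 0" using LeastI[of "\<lambda>m. k \<le> 2 ^ m" k] assms(1) unfolding m_def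
    by (metis less_exp less_imp_le not_less_eq_eq numeral_2_eq_2 power_0 One_nat_def)
  then have "2 ^ (m - 1) < k"
    using not_less_Least[of "m - 1" "\<lambda>m. k \<le> 2 ^ m"] unfolding m_def by simp
  then have "real (2 ^ (m - 1)) < real k" by (simp only: of_nat_less_iff)
  then have "real (m - 1) < log 2 k"
    using assms(1) by (simp add: less_log_iff powr_realpow)
  then have m: "real m + 1 \<le> 3 * log 2 k" using log \<open>m \<noteq> 0\<close> by simp
  have "real (2000 * (n + 1) * (k + 1)\<^sup>2 * (m + 1)) = 2000 * (real n + 1) * (real k + 1)\<^sup>2 * (real m + 1)"
    by (simp only: of_nat_mult of_nat_add of_nat_power of_nat_1 of_nat_numeral)
  also have "\<dots> \<le> 2000 * (2 * real n) * (2 * real k)\<^sup>2 * (3 * log 2 k)"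
    using assms(1,2) m by (intro mult_mono power_mono) auto
  finally show ?thesis by (simp add: power_mult_distrib)
qed

text \<open>The program and \<open>C\<close> are chosen before the instance. The time clause is
  restricted to \<open>k >= 2\<close> because \<open>log 2 1 = 0\<close>, and no execution takes
  zero time.\<close>

theorem theorem1:
  "\<exists>(prog :: com) (C :: real).
     \<forall>(X :: 'a set) (n :: nat) (d :: 'a \<Rightarrow> 'a \<Rightarrow> real) (\<I> :: 'a set set) (k :: nat) (e :: nat \<Rightarrow> 'a).
       finite X \<and> card X = n \<and> distance_on X d \<and> negative_type X d \<and>
       matroid X \<I> \<and> matroid_rank \<I> = k \<and> k \<ge> 1 \<and> bij_betw e {..<n} X \<longrightarrow>
       (\<exists>t A. returns prog n e d \<I> t A \<and>
          A \<in> \<I> \<and>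
          dispersion d A \<ge> (1 - 5 / real k) * Max {dispersion d S | S. S \<in> \<I>} \<and>
          (k \<ge> 2 \<longrightarrow> real t \<le> C * (real n * (real k)\<^sup>2 * log 2 (real k))))"
proof (rule exI[of _ local_search], rule exI[of _ 48000], intro allI impI, elim conjE)
  fix X :: "'a set" and n k :: nat and d :: "'a \<Rightarrow> 'a \<Rightarrow> real" and \<I> :: "'a set set" and e :: "nat \<Rightarrow> 'a"
  assume dist: "distance_on X d" and neg: "negative_type X d"
    and matroid: "matroid X \<I>" and rank: "matroid_rank \<I> = k" and k: "1 \<le> k"
    and e: "bij_betw e {..<n} X"
  interpret M: matroid X \<I> by (rule matroid)
  define orc where "orc = instance_oracles n e d \<I>"
  define m where "m = (LEAST m. k \<le> 2 ^ m)"
  interpret O: oracle_instance orc n k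
    unfolding orc_def using dist neg matroid rank e by (rule oracle_instance_instance_oracles)
  have inj: "inj_on e S" if "S \<subseteq> {..<n}" for S
    using e that by (meson bij_betw_imp_inj_on inj_on_subset)
  have indep: "indep_oracle orc S \<longleftrightarrow> S \<subseteq> {..<n} \<and> e ` S \<in> \<I>" for S
    by (simp add: orc_def instance_oracles_def)
  have disp: "dispersion d (e ` S) = dispersion (dist_oracle orc) S" if "S \<subseteq> {..<n}" for S
  proof (rule dispersion_image)
    show "distance_on (e ` S) d"
      using dist by (rule distance_on_subset) (use e that in \<open>auto simp: bij_betw_def\<close>)
    show "dist_oracle orc i j = d (e i) (e j)" if "i \<in> S" "j \<in> S" for i j
      using that \<open>S \<subseteq> {..<n}\<close> by (auto simp: orc_def instance_oracles_def)
  qed (use that inj finite_subset in auto)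

  have max: "{dispersion d S | S. S \<in> \<I>} = dispersion d ` \<I>" by blast
  obtain S where S: "S \<in> \<I>" "dispersion d S = Max (dispersion d ` \<I>)"
    using Max_in[of "dispersion d ` \<I>"] M.finite_family M.empty_indep by fastforce
  \<comment> \<open>Distances are nonnegative, so extending an optimal set to a basis keeps it
    optimal; the exchange argument compares sets of size \<open>k\<close>.\<close>
  obtain T where T: "T \<in> \<I>" "S \<subseteq> T" "card T = k"
    using M.extend_to_basis[OF S(1)] rank by blast
  have "dispersion d S \<le> dispersion d T"
    using M.finite_indep[OF T(1)] distance_on_subset[OF dist M.indep_subset[OF T(1)]] T(2)
    by (rule dispersion_mono)
  moreover have "dispersion d T \<le> Max (dispersion d ` \<I>)"
    using T M.finite_family by simp
  ultimately have opt: "dispersion d T = Max (dispersion d ` \<I>)" using S by simp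
  obtain B where B: "B \<subseteq> {..<n}" "e ` B = T"
    using M.indep_subset[OF T(1)] e by (metis bij_betw_def subset_imageE)
  have cardB: "card B = k" using T(3) B card_image[OF inj[OF B(1)]] by simp
  have "k \<le> n" using cardB B card_mono[of "{..<n}" B] by simp
  have "indep_oracle orc B" using B T by (simp add: indep)
  from O.runs_local_search[OF this cardB] obtain t s where
    run: "exec orc local_search (input_state n) t s"
    and t: "t \<le> 2000 * (n + 1) * (k + 1)\<^sup>2 * (m + 1)"
    and s: "O.progress B (k * m) s"
    unfolding runs_def m_def by blast
  let ?A = "O.solution s"
  have out: "output_set s = ?A" and A: "indep_oracle orc ?A"
    using s by (auto simp: O.progress_def O.config_def O.solution_def output_set_def)
  then have A': "?A \<subseteq> {..<n}" "e ` ?A \<in> \<I>" by (auto simp: indep)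
  note nonneg = M.dispersion_nonneg_indep[OF dist]
  have "(1 - 5 / real k) * dispersion d T \<le> dispersion d (e ` ?A)"
  proof (cases "2 \<le> k")
    case True
    have "k \<le> 2 ^ m" unfolding m_def by (rule LeastI[of _ k]) (simp add: less_imp_le)
    from approximation_arith[OF True this nonneg[OF T(1)]]
    have "(1 - 5 / real k) * dispersion d T \<le> O.lower B (k * m)"
      using disp[OF B(1)] B(2) by (simp add: O.lower_def add.commute)
    also have "\<dots> \<le> dispersion d (e ` ?A)"
      using s disp[OF A'(1)] by (simp add: O.progress_def)
    finally show ?thesis .
  next
    \<comment> \<open>Only \<open>k = 1\<close> remains, where the factor \<open>1 - 5/k\<close> is
      negative.\<close>
    case False
    with k have "(1 - 5 / real k) * dispersion d T \<le> 0"
      using nonneg[OF T(1)] by (simp add: mult_le_0_iff)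
    with nonneg[OF A'(2)] show ?thesis by linarith
  qed
  moreover have "returns local_search n e d \<I> t (e ` ?A)"
    unfolding returns_def using run out A' by (auto simp: orc_def)
  moreover have "real t \<le> 48000 * (real n * (real k)\<^sup>2 * log 2 (real k))" if "2 \<le> k"
  proof -
    have "real t \<le> real (2000 * (n + 1) * (k + 1)\<^sup>2 * (m + 1))" using t by (simp only: of_nat_le_iff)
    with time_arith[OF that \<open>k \<le> n\<close>] show ?thesis unfolding m_def by linarith
  qed
  ultimately show "\<exists>t A. returns local_search n e d \<I> t A \<and> A \<in> \<I> \<and>
      dispersion d A \<ge> (1 - 5 / real k) * Max {dispersion d S | S. S \<in> \<I>} \<and>
      (k \<ge> 2 \<longrightarrow> real t \<le> 48000 * (real n * (real k)\<^sup>2 * log 2 (real k)))"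
    using A'(2) unfolding max opt by blast
qed

end
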